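(* Let $N\in[M]$ and $p\in(0,1]$, set $\omega_{\mathrm{av}}=\frac{M-N}{N(M-1)}(1-p)$ and choose a real $b>1$. Set $a=\max\Big(1-(1+b)(1-p)\frac{M-N}{N(M-1)},0\Big)$. Consider the iterates $(x^k)_{k\ge 0}$ and $(y^k)_{k\ge0}$ generated by the algorithm ELVIRA (defined in the context) with sampling size $N$, probability $p$ and stepsize $\gamma$ such that $$0<\gamma\le\frac1L\,\frac1{a+(1+b)^2\omega_{\mathrm{av}}},$$ and let $h_m^k=\nabla F_m(y^k)$ for $m\in[M]$, $k\ge0$. For every $k\ge 0$ define $$\Psi^k=\|x^k-x^\star\|^2+(b^2+b)\gamma^2\omega_{\mathrm{av}}\frac1{pM}\sum_{m=1}^M\|h_m^k-h_m^\star\|^2 .$$ Then, for every $k\ge0$, $\mathbb E[\Psi^k]\le c^k\Psi^0$, where $$c=1-\min\left\{\gamma\mu,\ p(1-b^{-2})\right\}.$$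
   Context: Convention: $\frac{M-N}{N(M-1)}$ is read as $0$ when $M=N=1$. Problem. Let $d\ge1$, $M\ge1$, $[M]=\{1,\dots,M\}$. Let $F_1,\dots,F_M:\mathbb R^d\to\mathbb R$ be convex, differentiable and $L$-smooth for some $L>0$ (i.e. $\nabla F_m$ is $L$-Lipschitz), let $F=\frac1M\sum_{m=1}^M F_m$ be $\mu$-strongly convex for some $\mu>0$ (i.e. $F-\frac\mu2\|\cdot\|^2$ is convex), and let $R:\mathbb R^d\to\mathbb R\cup\{+\infty\}$ be proper, closed, convex. Let $x^\star$ be the unique minimizer of $R+F$ and $h_m^\star=\nabla F_m(x^\star)$. For $\gamma>0$, $\mathrm{prox}_{\gamma R}(w)=\arg\min_{x}\big(\gamma R(x)+\frac12\|x-w\|^2\big)$. Norms are Euclidean. Algorithm ELVIRA. Input: stepsize $\gamma>0$, sampling size $N\in[M]$, probability $p\in(0,1]$, deterministic $x^0\in\mathbb R^d$; $h^0=\frac1M\sum_{m=1}^M\nabla F_m(x^0)$, $y^0=x^0$. For $k=0,1,\dots$: pick randomly $s^k=1$ with probability $p$ and $s^k=0$ with probability $1-p$. If $s^k=1$: set $h^{k+1}=\frac1M\sum_{m=1}^M\nabla F_m(x^k)$, $x^{k+1}=\mathrm{prox}_{\gamma R}(x^k-\gamma h^{k+1})$, $y^{k+1}=x^k$. If $s^k=0$: pick $\Omega^k\subset[M]$ of size $N$ uniformly at random, set $d^{k+1}=\frac1N\sum_{m\in\Omega^k}\big(\nabla F_m(x^k)-\nabla F_m(y^k)\big)$, $x^{k+1}=\mathrm{prox}_{\gamma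 R}\big(x^k-\gamma(h^k+d^{k+1})\big)$, $h^{k+1}=h^k$, $y^{k+1}=y^k$. The random choices made at different iterations are independent, and, given $s^k=0$, $\Omega^k$ is uniform among the subsets of size $N$. *)

theory Defs
  imports "HOL-Probability.Probability"
begin

definition gradient :: "('a::euclidean_space \<Rightarrow> real) \<Rightarrow> 'a \<Rightarrow> 'a" where
  "gradient f x = (THE g. GDERIV f x :> g)"

definition strongly_convex :: "real \<Rightarrow> ('a::real_normed_vector \<Rightarrow> real) \<Rightarrow> bool" where
  "strongly_convex \<mu> f \<longleftrightarrow> convex_on UNIV (\<lambda>x. f x - \<mu> / 2 * (norm x)\<^sup>2)"

definition avg :: "nat set \<Rightarrow> (nat \<Rightarrow> 'a::real_vector) \<Rightarrow> 'a" where
  "avg I v = (1 / real (card I)) *\<^sub>R (\<Sum>m\<in>I. v m)"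

(* The library notion epigraph is restricted to real-valued functions. *)
definition ext_epigraph :: "('a \<Rightarrow> ereal) \<Rightarrow> ('a \<times> real) set" where
  "ext_epigraph f = {(x, t). f x \<le> ereal t}"

definition proper_closed_convex :: "('a::real_normed_vector \<Rightarrow> ereal) \<Rightarrow> bool" where
  "proper_closed_convex f \<longleftrightarrow>
     (\<forall>x. f x \<noteq> -\<infinity>) \<and> (\<exists>x. f x \<noteq> \<infinity>) \<and>
     closed (ext_epigraph f) \<and> convex (ext_epigraph f)"

definition minimizer :: "('a \<Rightarrow> ereal) \<Rightarrow> 'a" where
  "minimizer f = (ARG_MIN f x. True)"

definition prox :: "real \<Rightarrow> ('a::real_normed_vector \<Rightarrow> ereal) \<Rightarrow> 'a \<Rightarrow> 'a" where
  "prox \<gamma> R w = minimizer (\<lambda>x. ereal \<gamma> * R x + ereal (1 / 2 * (norm (x - w))\<^sup>2))"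

(* (M - N) / (N (M - 1)); division by zero in HOL makes this 0 when M = N = 1. *)
definition sampling_ratio :: "nat \<Rightarrow> nat \<Rightarrow> real" where
  "sampling_ratio M N = (real M - real N) / (real N * (real M - 1))"

(* The random choices (s k, \<Omega> k). Uniformity of \<Omega> k given s k = 0 is expressed through joint
   probabilities, so that the case p = 1 (conditioning on a null event) needs no exception.
   Where s k holds, \<Omega> k is not used by the algorithm and its value is left arbitrary. *)
definition elvira_sampling ::
  "'w measure \<Rightarrow> nat \<Rightarrow> nat \<Rightarrow> real \<Rightarrow> (nat \<Rightarrow> 'w \<Rightarrow> bool) \<Rightarrow> (nat \<Rightarrow> 'w \<Rightarrow> nat set) \<Rightarrow> bool" where
  "elvira_sampling P M N p s \<Omega> \<longleftrightarrow>
     prob_space.indep_vars P (\<lambda>k. count_space (UNIV \<times> Pow {1..M})) (\<lambda>k w. (s k w, \<Omega> k w)) UNIV \<and>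
     (\<forall>k. measure P {w \<in> space P. s k w} = p) \<and>
     (\<forall>k A. A \<subseteq> {1..M} \<longrightarrow> card A = N \<longrightarrow>
        measure P {w \<in> space P. \<not> s k w \<and> \<Omega> k w = A} = (1 - p) * (1 / real (M choose N)))"

definition elvira_run ::
  "nat \<Rightarrow> nat \<Rightarrow> (nat \<Rightarrow> 'a::euclidean_space \<Rightarrow> real) \<Rightarrow> ('a \<Rightarrow> ereal) \<Rightarrow> real \<Rightarrow> 'a \<Rightarrow>
   (nat \<Rightarrow> bool) \<Rightarrow> (nat \<Rightarrow> nat set) \<Rightarrow> (nat \<Rightarrow> 'a) \<Rightarrow> (nat \<Rightarrow> 'a) \<Rightarrow> (nat \<Rightarrow> 'a) \<Rightarrow> bool" where
  "elvira_run M N F R \<gamma> x0 s \<Omega> x h y \<longleftrightarrow>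
     x 0 = x0 \<and> h 0 = avg {1..M} (\<lambda>m. gradient (F m) x0) \<and> y 0 = x0 \<and>
     (\<forall>k. if s k
        then h (Suc k) = avg {1..M} (\<lambda>m. gradient (F m) (x k)) \<and>
             x (Suc k) = prox \<gamma> R (x k - \<gamma> *\<^sub>R h (Suc k)) \<and>
             y (Suc k) = x k
        else (let d = (1 / real N) *\<^sub>R (\<Sum>m\<in>\<Omega> k. gradient (F m) (x k) - gradient (F m) (y k)) in
             x (Suc k) = prox \<gamma> R (x k - \<gamma> *\<^sub>R (h k + d)) \<and>
             h (Suc k) = h k \<and>
             y (Suc k) = y k))"

end

theory Submission
  imports Defs
begin

text \<open>
  Nonexpansiveness of the proximal map bounds the squared distance to \<open>xstar\<close> after a step by
  the squared norm of \<open>x - xstar - \<gamma> (e - \<nabla>F(xstar))\<close>, where \<open>e\<close> is the gradient estimate. The estimate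
  is unbiased, so its mean contributes a gradient step and its variance an extra term
  \<open>\<gamma>\<^sup>2 \<omega>av\<close> times the empirical variance of \<open>\<nabla>F m x - \<nabla>F m y\<close>. Young's inequality with
  parameter \<open>b\<close> splits this variance into a part at \<open>x\<close> and a part at \<open>y\<close>, both relative to \<open>xstar\<close>.
  The part at \<open>x\<close> consumes one copy of \<open>\<gamma> \<langle>\<nabla>F x - \<nabla>F xstar, x - xstar\<rangle>\<close> by cocoercivity and the
  stepsize condition, the second copy gives the factor \<open>1 - \<gamma> \<mu>\<close> by strong convexity; the part at
  \<open>y\<close> is absorbed by the second summand of the Lyapunov function, which the reset of \<open>y\<close> with
  probability \<open>p\<close> contracts by \<open>1 - p (1 - 1 / b\<^sup>2)\<close>. The iterate is a function of finitely many
  past choices, independent of the current one, so the one-step bound can be iterated.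
\<close>

subsection \<open>Gradients of smooth convex functions\<close>

text \<open>Riesz representation in coordinates yields a gradient vector, and uniqueness of the
  derivative shows that it is the only one, so the \<open>THE\<close> in \<open>gradient\<close>
  denotes it.\<close>

lemma GDERIV_gradient:
  fixes f :: "'a::euclidean_space \<Rightarrow> real"
  assumes "f differentiable (at x)"
  shows "GDERIV f x :> gradient f x"
proof -
  obtain D where D: "(f has_derivative D) (at x)"
    using assms by (auto simp: differentiable_def)
  then interpret D: linear D
    by (rule has_derivative_linear)
  define g where "g = (\<Sum>b\<in>Basis. D b *\<^sub>R b)"
  have "D = (\<lambda>h. inner h g)"
  proof
    fix h
    have "D h = D (\<Sum>b\<in>Basis. (h \<bullet> b) *\<^sub>R b)"
      by (simp add: euclidean_representation)
    also have "\<dots> = inner h g"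
      by (simp add: D.sum D.scale g_def inner_sum_right mult.commute)
    finally show "D h = inner h g" .
  qed
  then have g: "GDERIV f x :> g"
    using D by (simp add: gderiv_def)
  have "g' = g" if "GDERIV f x :> g'" for g'
  proof -
    have "(\<lambda>h. inner h g') = (\<lambda>h. inner h g)"
      using that g unfolding gderiv_def by (rule has_derivative_unique)
    then show ?thesis
      by (metis inner_commute vector_eq_rdot)
  qed
  with g show ?thesis
    unfolding gradient_def by (metis the_equality)
qed

lemma has_field_derivative_along_line:
  fixes f :: "'a::real_inner \<Rightarrow> real"
  assumes "GDERIV f (x + t *\<^sub>R d) :> g"
  shows "((\<lambda>t. f (x + t *\<^sub>R d)) has_field_derivative g \<bullet> d) (at t)"
proof -
  have "((\<lambda>t. f (x + t *\<^sub>R d)) has_derivative (\<lambda>s. inner (s *\<^sub>R d) g)) (at t)"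
    using assms unfolding gderiv_def
    by (rule has_derivative_compose[rotated]) (auto intro!: derivative_eq_intros)
  then show ?thesis
    by (simp add: has_field_derivative_def inner_commute mult_commute_abs)
qed

text \<open>Restricting \<open>f\<close> to \<open>x + t (y - x)\<close> reduces the claim to the
  tangent inequality for a convex function of one real variable.\<close>

lemma convex_gradient_ineq:
  fixes f :: "'a::real_inner \<Rightarrow> real"
  assumes "convex_on UNIV f" and "GDERIV f x :> g"
  shows "f x + g \<bullet> (y - x) \<le> f y"
proof -
  define \<phi> where "\<phi> t = f (x + t *\<^sub>R (y - x))" for t
  have "convex_on UNIV \<phi>"
  proof (rule convex_onI)
    fix t r s :: real
    assume t: "0 < t" "t < 1"
    have *: "x + ((1 - t) *\<^sub>R r + t *\<^sub>R s) *\<^sub>R (y - x) =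
        (1 - t) *\<^sub>R (x + r *\<^sub>R (y - x)) + t *\<^sub>R (x + s *\<^sub>R (y - x))"
      by (simp add: algebra_simps)
    show "\<phi> ((1 - t) *\<^sub>R r + t *\<^sub>R s) \<le> (1 - t) * \<phi> r + t * \<phi> s"
      unfolding \<phi>_def * by (rule convex_onD[OF assms(1)]) (use t in auto)
  qed auto
  moreover have "(\<phi> has_field_derivative g \<bullet> (y - x)) (at 0)"
    unfolding \<phi>_def by (rule has_field_derivative_along_line) (use assms(2) in simp)
  ultimately have "\<phi> 1 - \<phi> 0 \<ge> g \<bullet> (y - x) * (1 - 0)"
    by (intro convex_on_imp_above_tangent[where A = UNIV]) auto
  then show ?thesis
    by (simp add: \<phi>_def)
qed

lemma lipschitz_gradient_upper_bound:
  fixes f :: "'a::real_inner \<Rightarrow> real"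
  assumes f: "\<And>z. GDERIV f z :> g z" and g: "L-lipschitz_on UNIV g"
  shows "f y \<le> f x + g x \<bullet> (y - x) + L / 2 * (norm (y - x))\<^sup>2"
proof -
  define d where "d = y - x"
  \<comment> \<open>\<open>\<psi>\<close> is \<open>f\<close> along the segment minus the
    non-constant terms of the bound. Its derivative is nonpositive for \<open>t \<ge> 0\<close> by
    Cauchy-Schwarz and the Lipschitz condition, and the claim is
    \<open>\<psi> 1 \<le> \<psi> 0\<close>.\<close>
  define \<psi> where "\<psi> t = f (x + t *\<^sub>R d) - t * (g x \<bullet> d) - L / 2 * t\<^sup>2 * (norm d)\<^sup>2" for t
  have der: "(\<psi> has_field_derivative
      (g (x + t *\<^sub>R d) - g x) \<bullet> d - L * t * (norm d)\<^sup>2) (at t)" for t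
    unfolding \<psi>_def
    by (rule derivative_eq_intros has_field_derivative_along_line[OF f] refl)+
      (simp add: inner_diff_left)
  have nonpos: "(g (x + t *\<^sub>R d) - g x) \<bullet> d - L * t * (norm d)\<^sup>2 \<le> 0" if "0 \<le> t" for t
  proof -
    have "(g (x + t *\<^sub>R d) - g x) \<bullet> d \<le> norm (g (x + t *\<^sub>R d) - g x) * norm d"
      by (rule norm_cauchy_schwarz)
    also have "\<dots> \<le> (L * norm (t *\<^sub>R d)) * norm d"
      using lipschitz_onD[OF g, of "x + t *\<^sub>R d" x]
      by (intro mult_right_mono) (auto simp: dist_norm)
    finally show ?thesis
      using that by (simp add: power2_eq_square mult.assoc)
  qed
  have "\<psi> 1 \<le> \<psi> 0"
  proof (rule DERIV_nonpos_imp_nonincreasing[of 0 1 \<psi>])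
    show "\<exists>D. (\<psi> has_field_derivative D) (at t) \<and> D \<le> 0" if "0 \<le> t" for t
      using der[of t] nonpos[OF that] by blast
  qed simp
  then show ?thesis
    by (simp add: \<psi>_def d_def)
qed

text \<open>Baillon-Haddad argument: the tangent inequality is sharpened by a squared gradient
  difference and then added to its copy with \<open>x\<close> and \<open>y\<close>
  exchanged.\<close>

lemma gradient_cocoercive:
  fixes f :: "'a::real_inner \<Rightarrow> real"
  assumes convex: "convex_on UNIV f" and f: "\<And>z. GDERIV f z :> g z"
    and g: "L-lipschitz_on UNIV g" and L: "L > 0"
  shows "(norm (g x - g y))\<^sup>2 / L \<le> (g x - g y) \<bullet> (x - y)"
proof -
  have *: "f x + g x \<bullet> (y - x) + (norm (g x - g y))\<^sup>2 / (2 * L) \<le> f y" for x y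
  proof -
    define e where "e = g y - g x"
    \<comment> \<open>This point minimizes the quadratic upper bound of \<open>f\<close> around
      \<open>y\<close> minus the tangent of \<open>f\<close> at \<open>x\<close>; comparing both
      bounds there gains \<open>(norm e)\<^sup>2 / (2 * L)\<close>.\<close>
    define z where "z = y - (1 / L) *\<^sub>R e"
    have "f x + g x \<bullet> (z - x) \<le> f z"
      by (rule convex_gradient_ineq[OF convex f])
    also have "f z \<le> f y + g y \<bullet> (z - y) + L / 2 * (norm (z - y))\<^sup>2"
      by (rule lipschitz_gradient_upper_bound[OF f g])
    also have "(norm (z - y))\<^sup>2 = (norm e)\<^sup>2 / L\<^sup>2"
      by (simp add: z_def power_divide)
    finally have "f x + g x \<bullet> (y - x) + e \<bullet> e / L - L / 2 * ((norm e)\<^sup>2 / L\<^sup>2) \<le> f y"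
      by (simp add: z_def e_def inner_diff inner_commute diff_divide_distrib add_divide_distrib algebra_simps)
    moreover have "e \<bullet> e / L - L / 2 * ((norm e)\<^sup>2 / L\<^sup>2) = (norm (g x - g y))\<^sup>2 / (2 * L)"
      using L by (simp add: e_def norm_minus_commute field_simps power2_eq_square flip: power2_norm_eq_inner)
    ultimately show ?thesis
      by linarith
  qed
  have "(norm (g y - g x))\<^sup>2 / (2 * L) = (norm (g x - g y))\<^sup>2 / (2 * L)"
    by (simp add: norm_minus_commute)
  then have "(norm (g x - g y))\<^sup>2 / (2 * L) + (norm (g x - g y))\<^sup>2 / (2 * L) \<le>
      - (g x \<bullet> (y - x)) - g y \<bullet> (x - y)"
    using *[of x y] *[of y x] by linarith
  then show ?thesis
    by (simp add: inner_diff algebra_simps)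
qed

lemma strongly_convex_gradient_ineq:
  fixes f :: "'a::real_inner \<Rightarrow> real"
  assumes "strongly_convex \<mu> f" and f: "GDERIV f x :> g"
  shows "f x + g \<bullet> (y - x) + \<mu> / 2 * (norm (y - x))\<^sup>2 \<le> f y"
proof -
  have "GDERIV (\<lambda>z. f z - \<mu> / 2 * (norm z)\<^sup>2) x :> g - \<mu> *\<^sub>R x"
    using f unfolding gderiv_def power2_norm_eq_inner
    by (auto intro!: derivative_eq_intros simp: inner_diff_right inner_commute)
  from convex_gradient_ineq[OF assms(1)[unfolded strongly_convex_def] this, of y]
  have "f x - \<mu> / 2 * (norm x)\<^sup>2 + (g - \<mu> *\<^sub>R x) \<bullet> (y - x) \<le> f y - \<mu> / 2 * (norm y)\<^sup>2" .
  moreover have "\<mu> / 2 * (norm (y - x))\<^sup>2 =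
      \<mu> / 2 * (norm y)\<^sup>2 - \<mu> / 2 * (norm x)\<^sup>2 - \<mu> * (x \<bullet> (y - x))"
    by (simp add: power2_norm_eq_inner inner_diff inner_commute algebra_simps)
  ultimately show ?thesis
    unfolding inner_diff_left inner_scaleR_left by linarith
qed

lemma strongly_convex_gradient_monotone:
  fixes f :: "'a::real_inner \<Rightarrow> real"
  assumes "strongly_convex \<mu> f" and "GDERIV f x :> g" and "GDERIV f y :> g'"
  shows "\<mu> * (norm (x - y))\<^sup>2 \<le> (g - g') \<bullet> (x - y)"
  using strongly_convex_gradient_ineq[OF assms(1,2), of y]
    strongly_convex_gradient_ineq[OF assms(1,3), of x]
  by (simp add: norm_minus_commute inner_diff algebra_simps)

subsection \<open>The proximal map\<close>

text \<open>A point one unit below the graph is separated from the closed convex epigraph. The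
  hyperplane is not vertical, because the graph point straight above lies on its other side, so it
  can be solved for the last coordinate.\<close>

lemma proper_closed_convex_affine_minorant:
  fixes R :: "'a::euclidean_space \<Rightarrow> ereal"
  assumes R: "proper_closed_convex R"
  obtains u \<beta> where "\<And>z. ereal (u \<bullet> z + \<beta>) \<le> R z"
proof -
  obtain z0 where z0: "R z0 \<noteq> \<infinity>"
    using R by (auto simp: proper_closed_convex_def)
  then obtain r0 where r0: "R z0 = ereal r0"
    using R by (cases "R z0") (auto simp: proper_closed_convex_def)
  have "closed (ext_epigraph R)" "convex (ext_epigraph R)"
    using R by (auto simp: proper_closed_convex_def)
  moreover have "(z0, r0 - 1) \<notin> ext_epigraph R"
    by (simp add: ext_epigraph_def r0)
  ultimately obtain n \<beta> where "n \<bullet> (z0, r0 - 1) < \<beta>" and epi: "\<forall>q\<in>ext_epigraph R. \<beta> < n \<bullet> q"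
    using separating_hyperplane_closed_point by blast
  moreover obtain v \<tau> where n: "n = (v, \<tau>)"
    by fastforce
  ultimately have below: "v \<bullet> z0 + \<tau> * (r0 - 1) < \<beta>"
    by simp
  have above: "\<beta> < v \<bullet> z + \<tau> * t" if "R z \<le> ereal t" for z t
    using epi that by (force simp: n ext_epigraph_def)
  have "\<tau> > 0"
    using below above[of z0 r0] by (simp add: r0 algebra_simps)
  have "ereal ((- (1 / \<tau>) *\<^sub>R v) \<bullet> z + \<beta> / \<tau>) \<le> R z" for z
  proof (cases "R z")
    case (real t)
    then have "\<beta> < v \<bullet> z + \<tau> * t"
      using above by simp
    then show ?thesis
      using \<open>\<tau> > 0\<close> by (simp add: real field_simps)
  qed (use R in \<open>auto simp: proper_closed_convex_def\<close>)
  then show ?thesis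
    using that by blast
qed

text \<open>\<open>ARG_MIN\<close> is a Hilbert choice, so \<open>minimizer f\<close> attains the
  minimum as soon as some point does.\<close>

lemma minimizer_le:
  assumes "\<exists>z. \<forall>u. (f z :: ereal) \<le> f u"
  shows "f (minimizer f) \<le> f u"
proof -
  have "\<exists>z. is_arg_min f (\<lambda>_. True) z"
    using assms by (auto simp: is_arg_min_def not_less)
  then have "is_arg_min f (\<lambda>_. True) (minimizer f)"
    unfolding minimizer_def arg_min_def by (rule someI_ex)
  then show ?thesis
    by (simp add: is_arg_min_linorder)
qed

text \<open>The minimization is moved to the epigraph, where the objective
  \<open>\<gamma> * t + \<phi> z\<close> is real-valued and continuous, and closedness of the
  epigraph takes the place of lower semicontinuity of \<open>R\<close>. The lemma serves both the
  proximal map and the sum of \<open>R\<close> and \<open>F\<close>.\<close>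

lemma regularized_minimizer_exists:
  fixes R :: "'a::euclidean_space \<Rightarrow> ereal"
  assumes R: "proper_closed_convex R" and \<gamma>: "\<gamma> > 0" and cont: "continuous_on UNIV \<phi>"
    and \<kappa>: "\<kappa> > 0" and lower: "\<And>z. \<kappa> * (norm z)\<^sup>2 + v \<bullet> z + \<beta> \<le> \<phi> z"
  shows "\<exists>z. \<forall>u. ereal \<gamma> * R z + ereal (\<phi> z) \<le> ereal \<gamma> * R u + ereal (\<phi> u)"
proof -
  obtain z0 where "R z0 \<noteq> \<infinity>"
    using R by (auto simp: proper_closed_convex_def)
  then obtain r0 where r0: "R z0 = ereal r0"
    using R by (cases "R z0") (auto simp: proper_closed_convex_def)
  obtain u0 \<beta>0 where minorant: "\<And>z. ereal (u0 \<bullet> z + \<beta>0) \<le> R z"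
    using proper_closed_convex_affine_minorant[OF R] by blast
  define obj where "obj q = \<gamma> * snd q + \<phi> (fst q)" for q :: "'a \<times> real"
  define \<alpha> where "\<alpha> = obj (z0, r0)"
  \<comment> \<open>The sublevel set through the reference point \<open>(z0, r0)\<close> is nonempty
    and closed; once it is bounded, a minimizer of \<open>obj\<close> over it exists.\<close>
  define K where "K = ext_epigraph R \<inter> {q. obj q \<le> \<alpha>}"
  have cont_obj: "continuous_on A obj" for A
    unfolding obj_def
    by (intro continuous_intros continuous_on_compose2[OF cont]) auto
  have "closed K"
    unfolding K_def using R
    by (intro closed_Int closed_Collect_le cont_obj continuous_on_const)
       (auto simp: proper_closed_convex_def)
  \<comment> \<open>\<open>C\<close> and \<open>D\<close> collect the constant and linear terms in
    \<open>\<kappa> * (norm z)\<^sup>2 \<le> D * norm z + C\<close>, which forces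
    \<open>norm z \<le> (D + C) / \<kappa>\<close> unless \<open>norm z \<le> 1\<close>.
    \<open>B'\<close> then bounds \<open>t\<close> from below by the affine minorant and from above
    by the level \<open>\<alpha>\<close>.\<close>
  define C where "C = \<bar>\<alpha>\<bar> + \<bar>\<beta>\<bar> + \<gamma> * \<bar>\<beta>0\<bar>"
  define D where "D = norm v + \<gamma> * norm u0"
  define B where "B = (D + C) / \<kappa> + 1"
  define B' where "B' = norm u0 * B + \<bar>\<beta>0\<bar> + (\<bar>\<alpha>\<bar> + norm v * B + \<bar>\<beta>\<bar>) / \<gamma>"
  have bound: "norm z \<le> B \<and> \<bar>t\<bar> \<le> B'" if "(z, t) \<in> K" for z t
  proof -
    have "ereal (u0 \<bullet> z + \<beta>0) \<le> ereal t"
      using that by (intro order_trans[OF minorant]) (simp add: K_def ext_epigraph_def)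
    then have t: "u0 \<bullet> z + \<beta>0 \<le> t" by simp
    have obj: "\<gamma> * t + \<phi> z \<le> \<alpha>"
      using that by (simp add: K_def obj_def)
    have v: "\<bar>v \<bullet> z\<bar> \<le> norm v * norm z" and u0: "\<bar>u0 \<bullet> z\<bar> \<le> norm u0 * norm z"
      by (rule Cauchy_Schwarz_ineq2)+
    have "\<gamma> * (- (norm u0 * norm z) - \<bar>\<beta>0\<bar>) \<le> \<gamma> * t"
      using t u0 \<gamma> by (intro mult_left_mono) auto
    then have quad: "\<kappa> * (norm z)\<^sup>2 \<le> D * norm z + C"
      using obj lower[of z] v by (simp add: C_def D_def algebra_simps)
    have "C \<ge> 0" "D \<ge> 0"
      using \<gamma> by (auto simp: C_def D_def)
    have z: "norm z \<le> B"
    proof (cases "norm z \<le> 1")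
      case True
      have "0 \<le> (D + C) / \<kappa>"
        using \<open>C \<ge> 0\<close> \<open>D \<ge> 0\<close> \<kappa> by auto
      then show ?thesis
        using True unfolding B_def by linarith
    next
      case False
      then have "C \<le> C * norm z"
        using \<open>C \<ge> 0\<close> by (simp add: mult_le_cancel_left1)
      then have "(\<kappa> * norm z) * norm z \<le> (D + C) * norm z"
        using quad by (simp add: power2_eq_square algebra_simps)
      then have "\<kappa> * norm z \<le> D + C"
        by (rule mult_right_le_imp_le) (use False in linarith)
      then have "norm z \<le> (D + C) / \<kappa>"
        using \<kappa> by (simp add: field_simps)
      then show ?thesis
        by (simp add: B_def)
    qed
    have "norm u0 * norm z \<le> norm u0 * B" "norm v * norm z \<le> norm v * B"
      using z by (simp_all add: mult_left_mono)
    moreover have "0 \<le> \<kappa> * (norm z)\<^sup>2"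
      using \<kappa> by simp
    ultimately have up: "\<gamma> * t \<le> \<bar>\<alpha>\<bar> + norm v * B + \<bar>\<beta>\<bar>" and low: "- (norm u0 * B + \<bar>\<beta>0\<bar>) \<le> t"
      using obj lower[of z] v u0 t by linarith+
    have "0 \<le> norm v * B" "0 \<le> norm u0 * B"
      using z by (smt (verit) norm_ge_zero mult_nonneg_nonneg)+
    then have "0 \<le> (\<bar>\<alpha>\<bar> + norm v * B + \<bar>\<beta>\<bar>) / \<gamma>"
      using \<gamma> by simp
    moreover have "t \<le> (\<bar>\<alpha>\<bar> + norm v * B + \<bar>\<beta>\<bar>) / \<gamma>"
      using up \<gamma> by (simp add: field_simps)
    ultimately have "\<bar>t\<bar> \<le> B'"
      using low \<open>0 \<le> norm u0 * B\<close> unfolding B'_def by linarith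
    with z show ?thesis by simp
  qed
  have "bounded K"
  proof (rule bounded_subset)
    show "bounded (cball (0::'a) B \<times> cball (0::real) B')"
      by (intro bounded_Times bounded_cball)
    show "K \<subseteq> cball (0::'a) B \<times> cball (0::real) B'"
      using bound by auto
  qed
  with \<open>closed K\<close> have "compact K"
    by (simp add: compact_eq_bounded_closed)
  moreover have z0K: "(z0, r0) \<in> K"
    by (simp add: K_def ext_epigraph_def r0 \<alpha>_def)
  ultimately obtain q where q: "q \<in> K" and min: "\<And>q'. q' \<in> K \<Longrightarrow> obj q \<le> obj q'"
    using continuous_attains_inf[of K obj] cont_obj by blast
  obtain z t where zt: "q = (z, t)" by fastforce
  \<comment> \<open>A competitor above the level \<open>\<alpha>\<close> loses because
    \<open>q\<close> lies in \<open>K\<close>; passing from \<open>t\<close> to the possibly smaller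
    \<open>R z\<close> only lowers the left side.\<close>
  have "ereal \<gamma> * R z + ereal (\<phi> z) \<le> ereal \<gamma> * R u + ereal (\<phi> u)" for u
  proof (cases "R u")
    case (real r)
    have "obj (z, t) \<le> obj (u, r)"
    proof (cases "obj (u, r) \<le> \<alpha>")
      case True
      then show ?thesis
        using min[of "(u, r)"] real by (simp add: zt K_def ext_epigraph_def)
    next
      case False
      then show ?thesis
        using q by (simp add: zt K_def)
    qed
    then have *: "ereal \<gamma> * ereal t + ereal (\<phi> z) \<le> ereal \<gamma> * R u + ereal (\<phi> u)"
      by (simp add: real obj_def)
    have "ereal \<gamma> * R z \<le> ereal \<gamma> * ereal t"
      using q \<gamma> by (intro ereal_mult_left_mono) (auto simp: zt K_def ext_epigraph_def)
    then show ?thesis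
      using * by (meson add_right_mono order_trans)
  next
    case PInf
    then show ?thesis
      using \<gamma> by simp
  qed (use R in \<open>auto simp: proper_closed_convex_def\<close>)
  then show ?thesis by blast
qed

text \<open>Variational form of the inclusion of \<open>- g\<close> in the subdifferential of
  \<open>\<gamma> R\<close> at \<open>z\<close>: compare \<open>z\<close> with
  \<open>z + \<epsilon> (u - z)\<close>, bound \<open>R\<close> there by convexity of the epigraph,
  divide by \<open>\<epsilon>\<close> and let it decrease to 0.\<close>

lemma regularized_minimizer_optimality:
  fixes R :: "'a::euclidean_space \<Rightarrow> ereal"
  assumes R: "proper_closed_convex R" and \<gamma>: "\<gamma> > 0"
    and min: "\<And>u. ereal \<gamma> * R z + ereal (\<phi> z) \<le> ereal \<gamma> * R u + ereal (\<phi> u)"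
    and \<phi>: "GDERIV \<phi> z :> g"
  obtains r where "R z = ereal r" and "\<And>u t. R u = ereal t \<Longrightarrow> \<gamma> * r \<le> \<gamma> * t + g \<bullet> (u - z)"
proof -
  obtain z0 where "R z0 \<noteq> \<infinity>"
    using R by (auto simp: proper_closed_convex_def)
  then obtain r0 where r0: "R z0 = ereal r0"
    using R by (cases "R z0") (auto simp: proper_closed_convex_def)
  have "R z \<noteq> \<infinity>"
    using min[of z0] \<gamma> by (auto simp: r0)
  then obtain r where r: "R z = ereal r"
    using R by (cases "R z") (auto simp: proper_closed_convex_def)
  have "\<gamma> * r \<le> \<gamma> * t + g \<bullet> (u - z)" if t: "R u = ereal t" for u t
  proof -
    define \<psi> where "\<psi> \<epsilon> = \<phi> (z + \<epsilon> *\<^sub>R (u - z))" for \<epsilon>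
    have le: "\<gamma> * (r - t) \<le> (\<psi> \<epsilon> - \<psi> 0) / (\<epsilon> - 0)" if \<epsilon>: "\<epsilon> \<in> {0<..<1}" for \<epsilon>
    proof -
      have "(1 - \<epsilon>) *\<^sub>R (z, r) + \<epsilon> *\<^sub>R (u, t) \<in> ext_epigraph R"
        using R \<epsilon> r t by (intro convexD) (auto simp: proper_closed_convex_def ext_epigraph_def)
      then have "R (z + \<epsilon> *\<^sub>R (u - z)) \<le> ereal ((1 - \<epsilon>) * r + \<epsilon> * t)"
        by (simp add: ext_epigraph_def algebra_simps)
      then have "ereal \<gamma> * R (z + \<epsilon> *\<^sub>R (u - z)) \<le> ereal \<gamma> * ereal ((1 - \<epsilon>) * r + \<epsilon> * t)"
        using \<gamma> by (intro ereal_mult_left_mono) auto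
      then have "ereal \<gamma> * R z + ereal (\<phi> z) \<le>
          ereal \<gamma> * ereal ((1 - \<epsilon>) * r + \<epsilon> * t) + ereal (\<psi> \<epsilon>)"
        unfolding \<psi>_def using min[of "z + \<epsilon> *\<^sub>R (u - z)"]
        by (meson add_right_mono order_trans)
      then show ?thesis
        using \<epsilon> by (simp add: r \<psi>_def field_simps)
    qed
    have "(\<psi> has_field_derivative g \<bullet> (u - z)) (at 0)"
      unfolding \<psi>_def by (rule has_field_derivative_along_line) (use \<phi> in simp)
    then have "((\<lambda>\<epsilon>. (\<psi> \<epsilon> - \<psi> 0) / (\<epsilon> - 0)) \<longlongrightarrow> g \<bullet> (u - z)) (at_right 0)"
      unfolding has_field_derivative_iff by (rule tendsto_within_subset) simp
    moreover have "\<forall>\<^sub>F \<epsilon> in at_right 0. \<gamma> * (r - t) \<le> (\<psi> \<epsilon> - \<psi> 0) / (\<epsilon> - 0)"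
      using le by (intro eventually_at_rightI[of 0 1]) auto
    ultimately have "\<gamma> * (r - t) \<le> g \<bullet> (u - z)"
      by (intro tendsto_lowerbound) auto
    then show ?thesis by (simp add: algebra_simps)
  qed
  with r that show thesis by blast
qed

lemma prox_optimality:
  fixes R :: "'a::euclidean_space \<Rightarrow> ereal"
  assumes R: "proper_closed_convex R" and \<gamma>: "\<gamma> > 0"
  obtains r where "R (prox \<gamma> R w) = ereal r"
    and "\<And>u t. R u = ereal t \<Longrightarrow> \<gamma> * r \<le> \<gamma> * t + (prox \<gamma> R w - w) \<bullet> (u - prox \<gamma> R w)"
proof -
  let ?\<phi> = "\<lambda>x. 1 / 2 * (norm (x - w))\<^sup>2"
  have "\<exists>z. \<forall>u. ereal \<gamma> * R z + ereal (?\<phi> z) \<le> ereal \<gamma> * R u + ereal (?\<phi> u)"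
  proof (rule regularized_minimizer_exists[OF R \<gamma>])
    show "continuous_on UNIV ?\<phi>"
      by (intro continuous_intros)
    show "1 / 2 * (norm z)\<^sup>2 + (- w) \<bullet> z + 1 / 2 * (norm w)\<^sup>2 \<le> ?\<phi> z" for z
      by (simp add: power2_norm_eq_inner inner_diff inner_commute algebra_simps)
  qed simp
  then have min: "ereal \<gamma> * R (prox \<gamma> R w) + ereal (?\<phi> (prox \<gamma> R w)) \<le> ereal \<gamma> * R u + ereal (?\<phi> u)" for u
    unfolding prox_def by (rule minimizer_le)
  have "GDERIV ?\<phi> (prox \<gamma> R w) :> prox \<gamma> R w - w"
    unfolding gderiv_def power2_norm_eq_inner
    by (auto intro!: derivative_eq_intros simp: inner_diff_right inner_commute)
  from regularized_minimizer_optimality[OF R \<gamma> min this] that show thesis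
    by blast
qed

text \<open>Both \<open>xs\<close> and the proximal point satisfy a variational inequality. Testing
  each at the other point cancels the values of \<open>R\<close>, and Cauchy-Schwarz
  finishes.\<close>

lemma prox_forward_backward_nonexpansive:
  fixes R :: "'a::euclidean_space \<Rightarrow> ereal"
  assumes R: "proper_closed_convex R" and \<gamma>: "\<gamma> > 0"
    and sc: "strongly_convex \<mu> F" and \<mu>: "\<mu> > 0" and F: "\<And>z. GDERIV F z :> g z"
    and xs: "xs = minimizer (\<lambda>z. R z + ereal (F z))"
  shows "norm (prox \<gamma> R (x - \<gamma> *\<^sub>R e) - xs) \<le> norm (x - xs - \<gamma> *\<^sub>R (e - g xs))"
proof -
  \<comment> \<open>The factor \<open>ereal 1\<close> makes this an instance of the existence lemma;
    strong convexity at 0 provides its quadratic lower bound with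
    \<open>\<kappa> = \<mu> / 2\<close>.\<close>
  have "\<exists>z. \<forall>u. ereal 1 * R z + ereal (F z) \<le> ereal 1 * R u + ereal (F u)"
  proof (rule regularized_minimizer_exists[OF R])
    show "continuous_on UNIV F"
      using F by (auto intro!: continuous_at_imp_continuous_on has_derivative_continuous simp: gderiv_def)
    show "\<mu> / 2 * (norm z)\<^sup>2 + g 0 \<bullet> z + F 0 \<le> F z" for z
      using strongly_convex_gradient_ineq[OF sc F, of 0 z] by simp
  qed (use \<mu> in auto)
  then have "ereal 1 * R xs + ereal (F xs) \<le> ereal 1 * R u + ereal (F u)" for u
    unfolding xs using minimizer_le[of "\<lambda>z. R z + ereal (F z)" u] by (simp flip: one_ereal_def)
  then obtain r where r: "R xs = ereal r"
    and xs_opt: "\<And>u t. R u = ereal t \<Longrightarrow> 1 * r \<le> 1 * t + g xs \<bullet> (u - xs)"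
    by (rule regularized_minimizer_optimality[OF R zero_less_one _ F]) blast
  define z where "z = prox \<gamma> R (x - \<gamma> *\<^sub>R e)"
  obtain t where t: "R z = ereal t"
    and z_opt: "\<And>u t'. R u = ereal t' \<Longrightarrow> \<gamma> * t \<le> \<gamma> * t' + (z - (x - \<gamma> *\<^sub>R e)) \<bullet> (u - z)"
    unfolding z_def by (rule prox_optimality[OF R \<gamma>]) blast
  have "\<gamma> * r \<le> \<gamma> * (t + g xs \<bullet> (z - xs))"
    using xs_opt[OF t] \<gamma> by (intro mult_left_mono) auto
  moreover have "\<gamma> * t \<le> \<gamma> * r + (z - (x - \<gamma> *\<^sub>R e)) \<bullet> (xs - z)"
    by (rule z_opt[OF r])
  ultimately have "(z - xs) \<bullet> (z - xs) \<le> (x - xs - \<gamma> *\<^sub>R (e - g xs)) \<bullet> (z - xs)"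
    by (simp add: inner_diff inner_commute algebra_simps)
  also have "\<dots> \<le> norm (x - xs - \<gamma> *\<^sub>R (e - g xs)) * norm (z - xs)"
    by (rule norm_cauchy_schwarz)
  finally have "norm (z - xs) * norm (z - xs) \<le> norm (x - xs - \<gamma> *\<^sub>R (e - g xs)) * norm (z - xs)"
    by (simp add: power2_norm_eq_inner flip: power2_eq_square)
  then show ?thesis
    unfolding z_def[symmetric] by (cases "z = xs") (auto simp: mult_le_cancel_right)
qed

subsection \<open>Sampling without replacement\<close>

text \<open>Removing \<open>B\<close> is a bijection onto the subsets of \<open>I - B\<close> of
  size \<open>N - card B\<close>.\<close>

lemma card_subsets_containing:
  assumes "finite I" and "B \<subseteq> I" and "card B \<le> N"
  shows "card {A. A \<subseteq> I \<and> card A = N \<and> B \<subseteq> A} = (card I - card B) choose (N - card B)"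
proof -
  have fin: "finite A" if "A \<subseteq> I" for A
    using that assms(1) by (rule finite_subset)
  have "bij_betw (\<lambda>A. A - B) {A. A \<subseteq> I \<and> card A = N \<and> B \<subseteq> A}
      {A. A \<subseteq> I - B \<and> card A = N - card B}"
  proof (rule bij_betwI[where g = "\<lambda>A. A \<union> B"])
    show "(\<lambda>A. A \<union> B) \<in> {A. A \<subseteq> I - B \<and> card A = N - card B} \<rightarrow>
        {A. A \<subseteq> I \<and> card A = N \<and> B \<subseteq> A}"
    proof safe
      fix A assume A: "A \<subseteq> I - B" "card A = N - card B"
      then have "finite A" "A \<inter> B = {}"
        using fin by auto
      then show "card (A \<union> B) = N"
        using A assms fin by (simp add: card_Un_disjoint)
    qed (use assms in auto)
  qed (use assms fin in \<open>auto simp: card_Diff_subset\<close>)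
  then have "card {A. A \<subseteq> I \<and> card A = N \<and> B \<subseteq> A} = card {A. A \<subseteq> I - B \<and> card A = N - card B}"
    by (rule bij_betw_same_card)
  also have "\<dots> = (card I - card B) choose (N - card B)"
    using assms fin by (simp add: n_subsets card_Diff_subset)
  finally show ?thesis .
qed

text \<open>Double counting: every index lies in the same number of subsets, so the total is a
  multiple of the sum over \<open>I\<close>. This gives unbiasedness of the sampled mean.\<close>

lemma sum_subset_sums_centered:
  fixes v :: "'i \<Rightarrow> 'a::real_vector"
  assumes "finite I" and "1 \<le> N" and "(\<Sum>m\<in>I. v m) = 0"
  shows "(\<Sum>A | A \<subseteq> I \<and> card A = N. \<Sum>m\<in>A. v m) = 0"
proof -
  define S where "S = {A. A \<subseteq> I \<and> card A = N}"
  have "finite S"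
    using assms(1) by (simp add: S_def)
  have "(\<Sum>A\<in>S. \<Sum>m\<in>A. v m) = (\<Sum>A\<in>S. \<Sum>m\<in>{m\<in>I. m \<in> A}. v m)"
    by (intro sum.cong refl) (auto simp: S_def)
  also have "\<dots> = (\<Sum>m\<in>I. \<Sum>A\<in>{A\<in>S. m \<in> A}. v m)"
    by (rule sum.swap_restrict) fact+
  also have "\<dots> = (\<Sum>m\<in>I. ((card I - 1) choose (N - 1)) *\<^sub>R v m)"
  proof (intro sum.cong refl)
    fix m assume "m \<in> I"
    then have "card {A\<in>S. m \<in> A} = (card I - 1) choose (N - 1)"
      using card_subsets_containing[of I "{m}" N] assms by (simp add: S_def conj_assoc)
    then show "(\<Sum>A\<in>{A\<in>S. m \<in> A}. v m) = ((card I - 1) choose (N - 1)) *\<^sub>R v m"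
      by (simp only: sum_constant_scaleR)
  qed
  also have "\<dots> = 0"
    by (simp add: assms(3) flip: scaleR_sum_right)
  finally show ?thesis
    by (simp add: S_def)
qed

text \<open>Expanding the square leaves inner products weighted by the number of subsets that
  contain both indices. That number takes one value on the diagonal and another off it, and
  centering removes the constant part. The denominators are cleared, so that \<open>M = 1\<close>
  fits the same formula.\<close>

lemma sum_norm_subset_sums_centered:
  fixes v :: "'i \<Rightarrow> 'a::real_inner"
  assumes I: "finite I" "card I = M" and N: "1 \<le> N" "N \<le> M" and v: "(\<Sum>m\<in>I. v m) = 0"
  shows "real M * (real M - 1) * (\<Sum>A | A \<subseteq> I \<and> card A = N. (norm (\<Sum>m\<in>A. v m))\<^sup>2) =
    real N * (real M - real N) * real (M choose N) * (\<Sum>m\<in>I. (norm (v m))\<^sup>2)"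
proof -
  define S where "S = {A. A \<subseteq> I \<and> card A = N}"
  define \<alpha> where "\<alpha> = real ((M - 1) choose (N - 1))"
  \<comment> \<open>For \<open>N = 1\<close> no subset contains two distinct indices, whereas
    truncated subtraction would turn the binomial into 1.\<close>
  define \<delta> where "\<delta> = (if N = 1 then 0 else real ((M - 2) choose (N - 2)))"
  have "finite S"
    using I by (simp add: S_def)
  have count: "real (card {A\<in>S. i \<in> A \<and> j \<in> A}) = (if i = j then \<alpha> else \<delta>)"
    if "i \<in> I" "j \<in> I" for i j
  proof (cases "i = j")
    case True
    then show ?thesis
      using card_subsets_containing[of I "{i}" N] I N that by (simp add: S_def \<alpha>_def conj_assoc)
  next
    case False
    show ?thesis
    proof (cases "N = 1")
      case True
      then have "{A\<in>S. i \<in> A \<and> j \<in> A} = {}"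
        using \<open>i \<noteq> j\<close> by (auto simp: S_def card_1_singleton_iff)
      then show ?thesis
        using \<open>i \<noteq> j\<close> True by (simp only: \<delta>_def card.empty) simp
    next
      case False
      then show ?thesis
        using card_subsets_containing[of I "{i, j}" N] I N that \<open>i \<noteq> j\<close>
        by (simp add: S_def \<delta>_def conj_assoc numeral_2_eq_2)
    qed
  qed
  have inner_sums: "(\<Sum>m\<in>J. v m) \<bullet> (\<Sum>m\<in>J. v m) = (\<Sum>i\<in>J. \<Sum>j\<in>J. v i \<bullet> v j)" for J
    unfolding inner_sum_left inner_sum_right by (rule sum.swap)
  have "(\<Sum>A\<in>S. (norm (\<Sum>m\<in>A. v m))\<^sup>2) = (\<Sum>A\<in>S. \<Sum>i\<in>I. \<Sum>j\<in>I. of_bool (i \<in> A \<and> j \<in> A) * (v i \<bullet> v j))"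
  proof (intro sum.cong refl)
    fix A assume "A \<in> S"
    then have "A \<subseteq> I" by (simp add: S_def)
    have "(norm (\<Sum>m\<in>A. v m))\<^sup>2 = (\<Sum>i\<in>A. \<Sum>j\<in>A. v i \<bullet> v j)"
      by (simp only: power2_norm_eq_inner inner_sums)
    also have "\<dots> = (\<Sum>i\<in>I. of_bool (i \<in> A) * (\<Sum>j\<in>I. of_bool (j \<in> A) * (v i \<bullet> v j)))"
      using I \<open>A \<subseteq> I\<close> by (simp add: sum.mono_neutral_cong_left[of I A] Int_absorb1 of_bool_def if_distrib[of "\<lambda>c. c * _"] sum.If_cases cong: if_cong)
    also have "\<dots> = (\<Sum>i\<in>I. \<Sum>j\<in>I. of_bool (i \<in> A \<and> j \<in> A) * (v i \<bullet> v j))"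
      by (simp add: sum_distrib_left of_bool_conj mult.assoc)
    finally show "(norm (\<Sum>m\<in>A. v m))\<^sup>2 = (\<Sum>i\<in>I. \<Sum>j\<in>I. of_bool (i \<in> A \<and> j \<in> A) * (v i \<bullet> v j))" .
  qed
  also have "\<dots> = (\<Sum>i\<in>I. \<Sum>j\<in>I. \<Sum>A\<in>S. of_bool (i \<in> A \<and> j \<in> A) * (v i \<bullet> v j))"
    by (simp add: sum.swap[of _ _ S])
  also have "\<dots> = (\<Sum>i\<in>I. \<Sum>j\<in>I. real (card {A\<in>S. i \<in> A \<and> j \<in> A}) * (v i \<bullet> v j))"
    using \<open>finite S\<close> by (simp add: Int_def flip: sum_distrib_right)
  \<comment> \<open>The weight is written as \<open>\<delta>\<close> everywhere plus a correction on
    the diagonal, so that the \<open>\<delta>\<close> part sums to a multiple of the squared norm of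
    the total, which is zero.\<close>
  also have "\<dots> = (\<Sum>i\<in>I. \<Sum>j\<in>I. \<delta> * (v i \<bullet> v j) + (if i = j then (\<alpha> - \<delta>) * (v i \<bullet> v j) else 0))"
    by (intro sum.cong refl) (auto simp: count algebra_simps)
  also have "\<dots> = \<delta> * ((\<Sum>i\<in>I. v i) \<bullet> (\<Sum>i\<in>I. v i)) + (\<alpha> - \<delta>) * (\<Sum>i\<in>I. (norm (v i))\<^sup>2)"
    using I by (simp add: sum.distrib inner_sums power2_norm_eq_inner
        flip: sum_distrib_left)
  finally have eq: "(\<Sum>A\<in>S. (norm (\<Sum>m\<in>A. v m))\<^sup>2) = (\<alpha> - \<delta>) * (\<Sum>i\<in>I. (norm (v i))\<^sup>2)"
    by (simp add: v)
  have "N * (M choose N) = M * ((M - 1) choose (N - 1))"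
    using N by (simp add: times_binomial_minus1_eq)
  then have \<alpha>: "real M * \<alpha> = real N * real (M choose N)"
    by (simp add: \<alpha>_def flip: of_nat_mult)
  \<comment> \<open>The absorption identity for binomials, used above for \<open>\<alpha>\<close>,
    applies once more with both arguments lowered by one.\<close>
  have \<delta>: "(real M - 1) * \<delta> = (real N - 1) * \<alpha>"
  proof (cases "N = 1")
    case False
    then have "(N - 1) * ((M - 1) choose (N - 1)) = (M - 1) * ((M - 1 - 1) choose (N - 1 - 1))"
      using N by (intro times_binomial_minus1_eq) simp
    then have "real (N - 1) * \<alpha> = real (M - 1) * \<delta>"
      using False by (simp add: \<alpha>_def \<delta>_def numeral_2_eq_2 flip: of_nat_mult)
    then show ?thesis
      using N by (simp add: of_nat_diff)
  qed (simp add: \<delta>_def)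
  have "(real M - 1) * (\<alpha> - \<delta>) = (real M - real N) * \<alpha>"
    using \<delta> by (simp add: algebra_simps)
  then have "real M * (real M - 1) * (\<alpha> - \<delta>) = (real M - real N) * (real M * \<alpha>)"
    by (simp add: mult.assoc mult.left_commute[of "real M"])
  then have "real M * (real M - 1) * (\<alpha> - \<delta>) = real N * (real M - real N) * real (M choose N)"
    unfolding \<alpha> by (simp add: mult_ac)
  then show ?thesis
    unfolding S_def[symmetric] eq by (simp flip: mult.assoc)
qed

section \<open>Empirical averages and variances, and the second moment of the sampled mean\<close>

lemma sum_minus_avg:
  assumes "finite I" and "I \<noteq> {}"
  shows "(\<Sum>m\<in>I. v m - avg I v) = 0"
  using assms by (simp add: avg_def sum_subtractf sum_constant_scaleR)

lemma avg_norm_minus_avg: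
  fixes v :: "nat \<Rightarrow> 'a::real_inner"
  assumes "finite I" and "I \<noteq> {}"
  shows "avg I (\<lambda>m. (norm (v m - avg I v))\<^sup>2) = avg I (\<lambda>m. (norm (v m))\<^sup>2) - (norm (avg I v))\<^sup>2"
proof -
  have card: "real (card I) > 0"
    using assms by (simp add: card_gt_0_iff)
  have sum: "(\<Sum>m\<in>I. v m) = real (card I) *\<^sub>R avg I v"
    using card by (simp add: avg_def)
  have "(norm (v m - avg I v))\<^sup>2 = (norm (v m))\<^sup>2 - 2 * (v m \<bullet> avg I v) + (norm (avg I v))\<^sup>2" for m
    by (simp add: power2_norm_eq_inner inner_diff inner_commute)
  then have "(\<Sum>m\<in>I. (norm (v m - avg I v))\<^sup>2) =
      (\<Sum>m\<in>I. (norm (v m))\<^sup>2) - 2 * ((\<Sum>m\<in>I. v m) \<bullet> avg I v) + real (card I) * (norm (avg I v))\<^sup>2"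
    by (simp add: sum.distrib sum_subtractf inner_sum_left sum_distrib_left)
  also have "\<dots> = (\<Sum>m\<in>I. (norm (v m))\<^sup>2) - real (card I) * (norm (avg I v))\<^sup>2"
    by (simp add: sum power2_norm_eq_inner)
  finally show ?thesis
    using card unfolding avg_def[of I "\<lambda>m. (norm (_ m))\<^sup>2"]
    by (simp add: field_simps)
qed

lemma norm_add_scaleR_sq:
  fixes u z :: "'a::real_inner"
  shows "(norm (u + r *\<^sub>R z))\<^sup>2 = (norm u)\<^sup>2 + 2 * r * (u \<bullet> z) + r\<^sup>2 * (norm z)\<^sup>2"
proof -
  have "(u + r *\<^sub>R z) \<bullet> (u + r *\<^sub>R z) = u \<bullet> u + (r * (u \<bullet> z) + r * (z \<bullet> u)) + r * (r * (z \<bullet> z))"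
    by (simp only: inner_add inner_scaleR_left inner_scaleR_right distrib_left add.assoc)
  also have "r * (u \<bullet> z) + r * (z \<bullet> u) = 2 * r * (u \<bullet> z)"
    by (simp add: inner_commute)
  finally show ?thesis
    by (simp only: power2_norm_eq_inner power2_eq_square[of r] mult.assoc)
qed

text \<open>Young's inequality: \<open>b\<close> times the squared norm of \<open>u + v / b\<close>
  is nonnegative, and this bounds the cross term.\<close>

lemma norm_diff_sq_le_weighted:
  fixes u v :: "'a::real_inner"
  assumes "b > 0"
  shows "(norm (u - v))\<^sup>2 \<le> (1 + b) * (norm u)\<^sup>2 + (1 + 1 / b) * (norm v)\<^sup>2"
proof -
  have "0 \<le> b * (norm (u + (1 / b) *\<^sub>R v))\<^sup>2"
    using assms by simp
  also have "\<dots> = b * (norm u)\<^sup>2 + 2 * (u \<bullet> v) + (1 / b) * (norm v)\<^sup>2"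
    using assms by (simp add: norm_add_scaleR_sq distrib_left) (simp add: power2_eq_square)
  finally show ?thesis
    using norm_add_scaleR_sq[of u "- 1" v] by (simp add: distrib_right)
qed

lemma avg_mono: "avg I u \<le> avg I v" if "\<And>m. m \<in> I \<Longrightarrow> u m \<le> (v m :: real)"
  using that by (simp add: avg_def sum_mono divide_right_mono)

lemma avg_add: "avg I (\<lambda>m. u m + v m) = avg I u + avg I v"
  by (simp add: avg_def sum.distrib scaleR_add_right)

lemma avg_diff: "avg I (\<lambda>m. u m - v m) = avg I u - avg I v"
  by (simp add: avg_def sum_subtractf scaleR_diff_right)

lemma avg_mult_left: "avg I (\<lambda>m. r * v m) = r * avg I v" for r :: real
  by (simp add: avg_def sum_distrib_left mult.left_commute)

lemma avg_inner_left: "avg I v \<bullet> u = avg I (\<lambda>m. v m \<bullet> u)"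
  by (simp add: avg_def inner_sum_left)

lemma avg_nonneg: "0 \<le> avg I v" if "\<And>m. m \<in> I \<Longrightarrow> 0 \<le> (v m :: real)"
  using that by (simp add: avg_def sum_nonneg)

text \<open>Young's inequality is applied to the centered vectors, so that only variances enter.\<close>

lemma variance_diff_le:
  fixes A B :: "nat \<Rightarrow> 'a::real_inner"
  assumes I: "finite I" "I \<noteq> {}" and b: "b > 0"
  shows "avg I (\<lambda>m. (norm ((A m - B m) - avg I (\<lambda>m. A m - B m)))\<^sup>2) \<le>
    (1 + b) * (avg I (\<lambda>m. (norm (A m))\<^sup>2) - (norm (avg I A))\<^sup>2) +
    (1 + 1 / b) * avg I (\<lambda>m. (norm (B m))\<^sup>2)"
proof -
  have "avg I (\<lambda>m. (norm ((A m - B m) - avg I (\<lambda>m. A m - B m)))\<^sup>2) =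
      avg I (\<lambda>m. (norm ((A m - avg I A) - (B m - avg I B)))\<^sup>2)"
    by (simp add: avg_diff algebra_simps)
  also have "\<dots> \<le> avg I (\<lambda>m. (1 + b) * (norm (A m - avg I A))\<^sup>2 +
      (1 + 1 / b) * (norm (B m - avg I B))\<^sup>2)"
    by (intro avg_mono norm_diff_sq_le_weighted b)
  also have "\<dots> = (1 + b) * (avg I (\<lambda>m. (norm (A m))\<^sup>2) - (norm (avg I A))\<^sup>2) +
      (1 + 1 / b) * (avg I (\<lambda>m. (norm (B m))\<^sup>2) - (norm (avg I B))\<^sup>2)"
    unfolding avg_add avg_mult_left avg_norm_minus_avg[OF I] ..
  \<comment> \<open>The squared mean is dropped for \<open>B\<close> only. For \<open>A\<close> it
    is kept, since it later offsets part of the squared mean produced by the gradient step.\<close>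
  also have "\<dots> \<le> (1 + b) * (avg I (\<lambda>m. (norm (A m))\<^sup>2) - (norm (avg I A))\<^sup>2) +
      (1 + 1 / b) * avg I (\<lambda>m. (norm (B m))\<^sup>2)"
    using b by (intro add_left_mono mult_left_mono) auto
  finally show ?thesis .
qed

text \<open>Bias-variance decomposition of the sampled mean, summed rather than averaged over the
  subsets: the cross term vanishes by unbiasedness, and the variance of sampling without replacement
  carries the factor \<open>sampling_ratio\<close>.\<close>

lemma subset_sampling_sq_norm:
  fixes v :: "nat \<Rightarrow> 'a::real_inner"
  assumes N: "N \<in> {1..M}"
  shows "(\<Sum>A | A \<subseteq> {1..M} \<and> card A = N.
      (norm (u + \<gamma> *\<^sub>R ((1 / real N) *\<^sub>R (\<Sum>m\<in>A. v m) - avg {1..M} v)))\<^sup>2) =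
    real (M choose N) * ((norm u)\<^sup>2 +
      \<gamma>\<^sup>2 * sampling_ratio M N * avg {1..M} (\<lambda>m. (norm (v m - avg {1..M} v))\<^sup>2))"
proof -
  define S where "S = {A. A \<subseteq> {1..M} \<and> card A = N}"
  define w where "w m = v m - avg {1..M} v" for m
  have card: "card S = M choose N"
    by (simp add: S_def n_subsets)
  have w0: "(\<Sum>m\<in>{1..M}. w m) = 0"
    unfolding w_def using N by (intro sum_minus_avg) auto
  have centered: "(1 / real N) *\<^sub>R (\<Sum>m\<in>A. v m) - avg {1..M} v = (1 / real N) *\<^sub>R (\<Sum>m\<in>A. w m)"
    if "A \<in> S" for A
    using that N by (simp add: S_def w_def sum_subtractf sum_constant_scaleR scaleR_diff_right)
  have mean: "(\<Sum>A\<in>S. \<Sum>m\<in>A. w m) = 0"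
    unfolding S_def using N w0 by (intro sum_subset_sums_centered) auto
  have var: "(\<Sum>A\<in>S. (norm (\<Sum>m\<in>A. w m))\<^sup>2) / (real N)\<^sup>2 =
      real (M choose N) * (sampling_ratio M N * avg {1..M} (\<lambda>m. (norm (w m))\<^sup>2))"
  proof (cases "M = 1")
    \<comment> \<open>Here \<open>sampling_ratio\<close> is 0 through division by zero, which
      matches the vanishing variance of the only possible sample.\<close>
    case True
    then have "w 1 = 0" using w0 by simp
    moreover have "N = 1" using True N by simp
    ultimately have "(\<Sum>m\<in>A. w m) = 0" if "A \<in> S" for A
      using that True by (auto simp: S_def subset_singleton_iff)
    then show ?thesis
      using True \<open>N = 1\<close> by (simp add: sampling_ratio_def)
  next
    case False
    have "real M * (real M - 1) * (\<Sum>A\<in>S. (norm (\<Sum>m\<in>A. w m))\<^sup>2) =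
        real N * (real M - real N) * real (M choose N) * (\<Sum>m\<in>{1..M}. (norm (w m))\<^sup>2)"
      unfolding S_def using N w0 by (intro sum_norm_subset_sums_centered) auto
    moreover have "real M \<noteq> 0" "real M - 1 \<noteq> 0" "real N \<noteq> 0"
      using False N by auto
    ultimately show ?thesis
      unfolding sampling_ratio_def avg_def card_atLeastAtMost diff_Suc_1 real_scaleR_def
      by (simp add: divide_simps power2_eq_square del: of_nat_eq_0_iff) (simp add: mult_ac)
  qed
  have "(\<Sum>A\<in>S. (norm (u + \<gamma> *\<^sub>R ((1 / real N) *\<^sub>R (\<Sum>m\<in>A. v m) - avg {1..M} v)))\<^sup>2) =
      (\<Sum>A\<in>S. (norm u)\<^sup>2 + 2 * (\<gamma> / real N) * (u \<bullet> (\<Sum>m\<in>A. w m)) +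
        \<gamma>\<^sup>2 * ((norm (\<Sum>m\<in>A. w m))\<^sup>2 / (real N)\<^sup>2))"
    by (intro sum.cong refl) (simp only: centered, simp add: norm_add_scaleR_sq power_divide)
  also have "\<dots> = real (M choose N) * (norm u)\<^sup>2 + 2 * (\<gamma> / real N) * (u \<bullet> (\<Sum>A\<in>S. \<Sum>m\<in>A. w m)) +
      \<gamma>\<^sup>2 * ((\<Sum>A\<in>S. (norm (\<Sum>m\<in>A. w m))\<^sup>2) / (real N)\<^sup>2)"
    by (simp add: sum.distrib card inner_sum_right sum_distrib_left sum_divide_distrib)
  finally show ?thesis
    unfolding mean var by (simp add: S_def w_def algebra_simps)
qed

subsection \<open>One step of ELVIRA\<close>

lemma elvira_one_step:
  fixes g :: "nat \<Rightarrow> 'a::real_inner \<Rightarrow> 'a" and T :: "'a \<Rightarrow> 'a"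
  assumes N: "N \<in> {1..M}" and p: "p \<in> {0<..1}" and b: "b > 1" and L: "L > 0" and \<gamma>: "\<gamma> > 0"
    and coco: "\<And>m. m \<in> {1..M} \<Longrightarrow> (norm (g m x - g m xs))\<^sup>2 / L \<le> (g m x - g m xs) \<bullet> (x - xs)"
    and mono: "\<mu> * (norm (x - xs))\<^sup>2 \<le> (avg {1..M} (\<lambda>m. g m x) - avg {1..M} (\<lambda>m. g m xs)) \<bullet> (x - xs)"
    and T: "\<And>e. norm (T e - xs) \<le> norm (x - xs - \<gamma> *\<^sub>R (e - avg {1..M} (\<lambda>m. g m xs)))"
    and \<omega>: "\<omega> = sampling_ratio M N * (1 - p)"
    and a: "a = max (1 - (1 + b) * (1 - p) * sampling_ratio M N) 0"
    and step: "\<gamma> \<le> 1 / L * (1 / (a + (1 + b)\<^sup>2 * \<omega>))"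
    and \<Psi>: "\<Psi> = (\<lambda>u v. (norm (u - xs))\<^sup>2 + (b\<^sup>2 + b) * \<gamma>\<^sup>2 * \<omega> * (1 / (p * real M)) *
           (\<Sum>m\<in>{1..M}. (norm (g m v - g m xs))\<^sup>2))"
    and c: "c = 1 - min (\<gamma> * \<mu>) (p * (1 - 1 / b\<^sup>2))"
  shows "p * \<Psi> (T (avg {1..M} (\<lambda>m. g m x))) x +
    (1 - p) / real (M choose N) * (\<Sum>A | A \<subseteq> {1..M} \<and> card A = N.
      \<Psi> (T (avg {1..M} (\<lambda>m. g m y) + (1 / real N) *\<^sub>R (\<Sum>m\<in>A. g m x - g m y))) y) \<le> c * \<Psi> x y"
proof -
  define S where "S = {A. A \<subseteq> {1..M} \<and> card A = N}"
  define C where "C = real (M choose N)"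
  define A where "A m = g m x - g m xs" for m
  define B where "B m = g m y - g m xs" for m
  define Av where "Av = avg {1..M} A"
  define q where "q = x - xs - \<gamma> *\<^sub>R Av"
  define D where "D = (norm (x - xs))\<^sup>2"
  define E where "E = Av \<bullet> (x - xs)"
  define SA where "SA = avg {1..M} (\<lambda>m. (norm (A m))\<^sup>2)"
  define SB where "SB = avg {1..M} (\<lambda>m. (norm (B m))\<^sup>2)"
  define V where "V = avg {1..M} (\<lambda>m. (norm ((A m - B m) - avg {1..M} (\<lambda>m. A m - B m)))\<^sup>2)"
  \<comment> \<open>The weight of the second summand of \<open>\<Psi>\<close> once the sum over
    \<open>m\<close> is written as an average.\<close>
  define \<beta> where "\<beta> = (b\<^sup>2 + b) * \<gamma>\<^sup>2 * \<omega> / p"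
  have "C > 0"
    using N by (simp add: C_def)
  have I: "finite {1..M}" "{1..M} \<noteq> {}"
    using N by auto
  have "0 \<le> sampling_ratio M N"
    using N by (auto simp: sampling_ratio_def intro!: divide_nonneg_nonneg mult_nonneg_nonneg)
  then have \<omega>0: "0 \<le> \<omega>" and \<beta>0: "0 \<le> \<beta>"
    using p b by (auto simp: \<omega> \<beta>_def intro!: divide_nonneg_nonneg mult_nonneg_nonneg)
  have SA0: "0 \<le> SA" and SB0: "0 \<le> SB"
    by (auto simp: SA_def SB_def intro: avg_nonneg)
  have \<Psi>': "\<Psi> u x = (norm (u - xs))\<^sup>2 + \<beta> * SA" "\<Psi> u y = (norm (u - xs))\<^sup>2 + \<beta> * SB" for u
    by (simp_all add: \<Psi> \<beta>_def SA_def SB_def avg_def A_def B_def)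
  have Av: "avg {1..M} (\<lambda>m. g m x) = avg {1..M} (\<lambda>m. g m xs) + Av"
    by (simp add: Av_def A_def[abs_def] avg_diff)
  have AB: "A m - B m = g m x - g m y" for m
    by (simp add: A_def B_def)
  have "(norm (T (avg {1..M} (\<lambda>m. g m x)) - xs))\<^sup>2 \<le> (norm q)\<^sup>2"
    using T[of "avg {1..M} (\<lambda>m. g m x)"] unfolding Av q_def
    by (intro power_mono) (simp_all only: add_diff_cancel_left' norm_ge_zero)
  then have full: "p * \<Psi> (T (avg {1..M} (\<lambda>m. g m x))) x \<le> p * ((norm q)\<^sup>2 + \<beta> * SA)"
    unfolding \<Psi>' using p by (intro mult_left_mono) auto
  have "(\<Sum>J\<in>S. \<Psi> (T (avg {1..M} (\<lambda>m. g m y) + (1 / real N) *\<^sub>R (\<Sum>m\<in>J. g m x - g m y))) y) \<le>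
      (\<Sum>J\<in>S. (norm (q + (- \<gamma>) *\<^sub>R ((1 / real N) *\<^sub>R (\<Sum>m\<in>J. A m - B m) - avg {1..M} (\<lambda>m. A m - B m))))\<^sup>2 + \<beta> * SB)"
  proof (intro sum_mono)
    fix J
    define e where "e = avg {1..M} (\<lambda>m. g m y) + (1 / real N) *\<^sub>R (\<Sum>m\<in>J. g m x - g m y)"
    \<comment> \<open>The exact gradient step \<open>q\<close> is split off, which leaves a centered
      sampling error with factor \<open>- \<gamma>\<close>.\<close>
    have "x - xs - \<gamma> *\<^sub>R (e - avg {1..M} (\<lambda>m. g m xs)) =
        q + (- \<gamma>) *\<^sub>R ((1 / real N) *\<^sub>R (\<Sum>m\<in>J. A m - B m) - avg {1..M} (\<lambda>m. A m - B m))"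
      unfolding AB e_def avg_diff Av q_def by (simp add: algebra_simps)
    then show "\<Psi> (T e) y \<le>
        (norm (q + (- \<gamma>) *\<^sub>R ((1 / real N) *\<^sub>R (\<Sum>m\<in>J. A m - B m) - avg {1..M} (\<lambda>m. A m - B m))))\<^sup>2 + \<beta> * SB"
      unfolding \<Psi>' using T[of e] by (simp add: power_mono)
  qed
  also have "\<dots> = C * ((norm q)\<^sup>2 + \<gamma>\<^sup>2 * sampling_ratio M N * V + \<beta> * SB)"
    unfolding sum.distrib S_def subset_sampling_sq_norm[OF N]
    by (simp add: C_def V_def n_subsets algebra_simps)
  finally have "(1 - p) / C * (\<Sum>J\<in>S. \<Psi> (T (avg {1..M} (\<lambda>m. g m y) + (1 / real N) *\<^sub>R (\<Sum>m\<in>J. g m x - g m y))) y) \<le>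
      (1 - p) / C * (C * ((norm q)\<^sup>2 + \<gamma>\<^sup>2 * sampling_ratio M N * V + \<beta> * SB))"
    using p \<open>C > 0\<close> by (intro mult_left_mono) auto
  also have "\<dots> = (1 - p) * (norm q)\<^sup>2 + \<gamma>\<^sup>2 * \<omega> * V + (1 - p) * \<beta> * SB"
    using \<open>C > 0\<close> by (simp add: \<omega>) (simp add: algebra_simps)
  finally have sampled: "(1 - p) / C * (\<Sum>J\<in>S. \<Psi> (T (avg {1..M} (\<lambda>m. g m y) + (1 / real N) *\<^sub>R (\<Sum>m\<in>J. g m x - g m y))) y) \<le>
      (1 - p) * (norm q)\<^sup>2 + \<gamma>\<^sup>2 * \<omega> * V + (1 - p) * \<beta> * SB" .

  have q: "(norm q)\<^sup>2 = D - 2 * \<gamma> * E + \<gamma>\<^sup>2 * (norm Av)\<^sup>2"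
    using norm_add_scaleR_sq[of "x - xs" "- \<gamma>" Av]
    by (simp add: q_def D_def E_def inner_commute)
  have "V \<le> (1 + b) * (SA - (norm Av)\<^sup>2) + (1 + 1 / b) * SB"
    unfolding V_def SA_def SB_def Av_def using b by (intro variance_diff_le I) simp
  then have V: "\<gamma>\<^sup>2 * \<omega> * V \<le> \<gamma>\<^sup>2 * \<omega> * ((1 + b) * (SA - (norm Av)\<^sup>2) + (1 + 1 / b) * SB)"
    using \<omega>0 by (intro mult_left_mono) auto
  have Av_SA: "(norm Av)\<^sup>2 \<le> SA"
    using avg_nonneg[of "{1..M}" "\<lambda>m. (norm (A m - avg {1..M} A))\<^sup>2"]
    unfolding avg_norm_minus_avg[OF I] Av_def SA_def by simp
  have a': "1 - (1 + b) * \<omega> \<le> a" "0 \<le> a"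
    by (simp_all add: a \<omega> mult_ac)
  \<comment> \<open>The coefficient on the left may be negative; it is first raised to the
    nonnegative \<open>a\<close>, after which the squared mean may be replaced by the larger mean of
    squares.\<close>
  have "(1 - (1 + b) * \<omega>) * (norm Av)\<^sup>2 \<le> a * SA"
    using a' Av_SA by (intro order_trans[OF mult_right_mono mult_left_mono]) auto
  then have aSA: "\<gamma>\<^sup>2 * ((1 - (1 + b) * \<omega>) * (norm Av)\<^sup>2) \<le> \<gamma>\<^sup>2 * (a * SA)"
    by (intro mult_left_mono) auto
  have "SA / L \<le> E"
    using avg_mono[of "{1..M}", OF coco]
    by (simp add: SA_def E_def Av_def A_def[abs_def] avg_inner_left flip: avg_mult_left[of _ "1 / L", simplified])
  \<comment> \<open>Positivity allows the stepsize bound to be multiplied out. For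
    \<open>\<omega> = 0\<close> the lower bound on \<open>a\<close> gives \<open>a \<ge> 1\<close>;
    otherwise the second summand is positive.\<close>
  have pos: "0 < a + (1 + b)\<^sup>2 * \<omega>"
  proof (cases "\<omega> = 0")
    case True
    then show ?thesis
      using a' by simp
  next
    case False
    then have "0 < (1 + b)\<^sup>2 * \<omega>"
      using \<omega>0 b by (intro mult_pos_pos) auto
    then show ?thesis
      using a' by linarith
  qed
  have "\<gamma> * (a + (1 + b)\<^sup>2 * \<omega>) \<le> 1 / L"
    using step pos_le_divide_eq[OF pos, of \<gamma> "1 / L"] by simp
  then have "\<gamma> * (\<gamma> * (a + (1 + b)\<^sup>2 * \<omega>) * SA) \<le> \<gamma> * (1 / L * SA)"
    using SA0 \<gamma> by (intro mult_left_mono mult_right_mono) auto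
  also have "\<dots> \<le> \<gamma> * E"
    using \<open>SA / L \<le> E\<close> \<gamma> by (intro mult_left_mono) auto
  finally have stepE: "\<gamma>\<^sup>2 * (a * SA) + \<gamma>\<^sup>2 * ((1 + b)\<^sup>2 * \<omega> * SA) \<le> \<gamma> * E"
    by (simp add: power2_eq_square algebra_simps)
  have "\<mu> * D \<le> E"
    using mono unfolding D_def E_def Av by simp
  then have \<mu>D: "\<gamma> * (\<mu> * D) \<le> \<gamma> * E"
    using \<gamma> by (intro mult_left_mono) auto
  have p\<beta>: "p * \<beta> = (b\<^sup>2 + b) * (\<gamma>\<^sup>2 * \<omega>)"
    using p by (simp add: \<beta>_def)
  \<comment> \<open>Young contributes \<open>1 + b\<close> and the reset of \<open>y\<close>
    contributes \<open>b\<^sup>2 + b\<close>; their sum is the \<open>(1 + b)\<^sup>2\<close> of the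
    stepsize condition.\<close>
  have SA_coeff: "\<gamma>\<^sup>2 * \<omega> * (1 + b) + p * \<beta> = \<gamma>\<^sup>2 * ((1 + b)\<^sup>2 * \<omega>)"
    unfolding p\<beta> by (simp add: power2_sum algebra_simps)
  \<comment> \<open>This explains the weight \<open>b\<^sup>2 + b\<close> in \<open>\<Psi>\<close>:
    the Young term at \<open>y\<close> is exactly the fraction \<open>1 / b\<^sup>2\<close> of
    \<open>p * \<beta>\<close>, so the total coefficient of \<open>SB\<close> is a contraction of
    \<open>\<beta>\<close>.\<close>
  have "(b\<^sup>2 + b) / b\<^sup>2 = 1 + 1 / b"
    using b by (simp add: add_divide_distrib power2_eq_square)
  then have "\<gamma>\<^sup>2 * \<omega> * (1 + 1 / b) = p * \<beta> / b\<^sup>2"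
    unfolding p\<beta> by (metis mult.commute times_divide_eq_right)
  then have SB_coeff: "\<gamma>\<^sup>2 * \<omega> * (1 + 1 / b) + (1 - p) * \<beta> = (1 - p * (1 - 1 / b\<^sup>2)) * \<beta>"
    by (simp add: algebra_simps)
  have "p * \<Psi> (T (avg {1..M} (\<lambda>m. g m x))) x +
      (1 - p) / C * (\<Sum>J\<in>S. \<Psi> (T (avg {1..M} (\<lambda>m. g m y) + (1 / real N) *\<^sub>R (\<Sum>m\<in>J. g m x - g m y))) y)
    \<le> (norm q)\<^sup>2 + \<gamma>\<^sup>2 * \<omega> * ((1 + b) * (SA - (norm Av)\<^sup>2) + (1 + 1 / b) * SB) + p * \<beta> * SA + (1 - p) * \<beta> * SB"
  proof -
    have "p * ((norm q)\<^sup>2 + \<beta> * SA) + (1 - p) * (norm q)\<^sup>2 = (norm q)\<^sup>2 + p * \<beta> * SA"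
      by (simp add: algebra_simps)
    then show ?thesis
      using full sampled V by linarith
  qed
  also have "\<dots> = D - 2 * \<gamma> * E + \<gamma>\<^sup>2 * ((1 - (1 + b) * \<omega>) * (norm Av)\<^sup>2) +
      (\<gamma>\<^sup>2 * \<omega> * (1 + b) + p * \<beta>) * SA + (\<gamma>\<^sup>2 * \<omega> * (1 + 1 / b) + (1 - p) * \<beta>) * SB"
    unfolding q by (simp add: algebra_simps)
  also have "\<dots> \<le> D - \<gamma> * E + (1 - p * (1 - 1 / b\<^sup>2)) * (\<beta> * SB)"
    unfolding SA_coeff SB_coeff mult.assoc[of _ \<beta> SB] mult.assoc[of "\<gamma>\<^sup>2" _ SA]
    using aSA stepE by linarith
  also have "\<dots> \<le> (1 - \<gamma> * \<mu>) * D + (1 - p * (1 - 1 / b\<^sup>2)) * (\<beta> * SB)"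
    using \<mu>D by (simp add: left_diff_distrib mult.assoc)
  also have "\<dots> \<le> c * D + c * (\<beta> * SB)"
  proof (intro add_mono mult_right_mono)
    show "1 - \<gamma> * \<mu> \<le> c" "1 - p * (1 - 1 / b\<^sup>2) \<le> c"
      unfolding c by linarith+
  qed (use \<beta>0 SB0 in \<open>simp_all add: D_def\<close>)
  also have "\<dots> = c * \<Psi> x y"
    unfolding \<Psi>' by (simp add: D_def distrib_left)
  finally show ?thesis
    unfolding S_def C_def .
qed

subsection \<open>Orbits driven by independent choices\<close>

lemma (in prob_space) finite_range_has_bochner_integral:
  fixes f :: "'b \<Rightarrow> real"
  assumes S: "finite S" and Y: "Y \<in> measurable M (count_space S)"
  shows "has_bochner_integral M (\<lambda>w. f (Y w)) (\<Sum>y\<in>S. prob {w \<in> space M. Y w = y} * f y)"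
proof -
  have sets: "{w \<in> space M. Y w = y} \<in> events" if "y \<in> S" for y
  proof -
    have "Y -` {y} \<inter> space M \<in> events"
      using that by (intro measurable_sets[OF Y]) simp
    moreover have "Y -` {y} \<inter> space M = {w \<in> space M. Y w = y}"
      by auto
    ultimately show ?thesis by simp
  qed
  have "has_bochner_integral M (\<lambda>w. \<Sum>y\<in>S. indicator {w \<in> space M. Y w = y} w * f y)
      (\<Sum>y\<in>S. prob {w \<in> space M. Y w = y} * f y)"
    by (intro has_bochner_integral_sum has_bochner_integral_mult_left has_bochner_integral_real_indicator)
      (use sets in \<open>auto simp: less_top[symmetric]\<close>)
  moreover have "(\<Sum>y\<in>S. indicator {w \<in> space M. Y w = y} w * f y) = f (Y w)" if w: "w \<in> space M" for w
  proof -
    have "(\<Sum>y\<in>S. indicator {w \<in> space M. Y w = y} w * f y) = (\<Sum>y\<in>S. if Y w = y then f y else 0)"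
      using w by (intro sum.cong refl) (auto simp: indicator_def)
    also have "\<dots> = f (Y w)"
      using S measurable_space[OF Y w] by simp
    finally show ?thesis .
  qed
  ultimately show ?thesis
    by (subst has_bochner_integral_cong[OF refl _ refl]) auto
qed

text \<open>Conditioning on \<open>Z\<close> in elementary form: the joint law factorizes, so the
  bound that averages over \<open>X\<close> with \<open>z\<close> frozen can be summed against the
  law of \<open>Z\<close>.\<close>

lemma (in prob_space) finite_range_indep_expectation_le:
  fixes f :: "'b \<Rightarrow> 'c \<Rightarrow> real"
  assumes S: "finite S" and D: "finite D"
    and Z: "Z \<in> measurable M (count_space S)" and X: "X \<in> measurable M (count_space D)"
    and indep: "\<And>z d. z \<in> S \<Longrightarrow> d \<in> D \<Longrightarrow> prob {w \<in> space M. Z w = z \<and> X w = d} =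
      prob {w \<in> space M. Z w = z} * prob {w \<in> space M. X w = d}"
    and le: "\<And>z. (\<Sum>d\<in>D. prob {w \<in> space M. X w = d} * f z d) \<le> r * g z"
  shows "integrable M (\<lambda>w. f (Z w) (X w))"
    and "expectation (\<lambda>w. f (Z w) (X w)) \<le> r * expectation (\<lambda>w. g (Z w))"
proof -
  have "(\<lambda>w. (Z w, X w)) \<in> measurable M (count_space S \<Otimes>\<^sub>M count_space D)"
    using Z X by (rule measurable_Pair)
  then have ZX: "(\<lambda>w. (Z w, X w)) \<in> measurable M (count_space (S \<times> D))"
    using S D by (simp add: pair_measure_countable countable_finite)
  have int: "has_bochner_integral M (\<lambda>w. f (Z w) (X w))
      (\<Sum>q\<in>S \<times> D. prob {w \<in> space M. (Z w, X w) = q} * f (fst q) (snd q))"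
    using finite_range_has_bochner_integral[OF _ ZX, of "\<lambda>q. f (fst q) (snd q)"] S D by simp
  then show "integrable M (\<lambda>w. f (Z w) (X w))"
    by (rule integrable.intros)
  have "expectation (\<lambda>w. f (Z w) (X w)) =
      (\<Sum>q\<in>S \<times> D. prob {w \<in> space M. (Z w, X w) = q} * f (fst q) (snd q))"
    using int by (rule has_bochner_integral_integral_eq)
  also have "\<dots> = (\<Sum>z\<in>S. \<Sum>d\<in>D. prob {w \<in> space M. (Z w, X w) = (z, d)} * f z d)"
    unfolding sum.cartesian_product by (intro sum.cong refl) auto
  also have "\<dots> = (\<Sum>z\<in>S. prob {w \<in> space M. Z w = z} * (\<Sum>d\<in>D. prob {w \<in> space M. X w = d} * f z d))"
    unfolding sum_distrib_left by (intro sum.cong refl) (simp add: indep mult.assoc)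
  also have "\<dots> \<le> (\<Sum>z\<in>S. prob {w \<in> space M. Z w = z} * (r * g z))"
    by (intro sum_mono mult_left_mono le) simp
  also have "\<dots> = r * (\<Sum>z\<in>S. prob {w \<in> space M. Z w = z} * g z)"
    by (simp add: sum_distrib_left mult.left_commute)
  also have "(\<Sum>z\<in>S. prob {w \<in> space M. Z w = z} * g z) = expectation (\<lambda>w. g (Z w))"
    using finite_range_has_bochner_integral[OF S Z, of g]
    by (rule has_bochner_integral_integral_eq[symmetric])
  finally show "expectation (\<lambda>w. f (Z w) (X w)) \<le> r * expectation (\<lambda>w. g (Z w))" .
qed

text \<open>The state is a deterministic function of the choice sequence, which exposes that the
  state at time \<open>k\<close> depends on the choices before \<open>k\<close> only.\<close>

primrec driven_orbit :: "('z \<Rightarrow> 'd \<Rightarrow> 'z) \<Rightarrow> 'z \<Rightarrow> (nat \<Rightarrow> 'd) \<Rightarrow> nat \<Rightarrow> 'z" where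
  "driven_orbit f z q 0 = z"
| "driven_orbit f z q (Suc k) = f (driven_orbit f z q k) (q k)"

lemma driven_orbit_cong:
  "(\<And>i. i < k \<Longrightarrow> q i = q' i) \<Longrightarrow> driven_orbit f z q k = driven_orbit f z q' k"
  by (induction k) auto

lemma (in prob_space) driven_orbit_expectation_le:
  fixes g :: "'z \<Rightarrow> real"
  assumes D: "finite D" and indep: "indep_vars (\<lambda>_. count_space D) \<xi> UNIV"
    and c: "c \<ge> 0"
    and le: "\<And>k z. (\<Sum>d\<in>D. prob {w \<in> space M. \<xi> k w = d} * g (f z d)) \<le> c * g z"
  shows "integrable M (\<lambda>w. g (driven_orbit f z0 (\<lambda>i. \<xi> i w) k)) \<and>
    expectation (\<lambda>w. g (driven_orbit f z0 (\<lambda>i. \<xi> i w) k)) \<le> c ^ k * g z0"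
proof (induction k)
  case 0
  then show ?case by (simp add: prob_space)
next
  case (Suc k)
  define Q where "Q = PiE {..<k} (\<lambda>_. D)"
  define Z where "Z q = driven_orbit f z0 q k" for q
  have "finite Q"
    unfolding Q_def using D by (intro finite_PiE) auto
  \<comment> \<open>A finite product of finite discrete spaces is discrete, so every set of choice
    histories is measurable, and the state takes only finitely many values.\<close>
  have PiM: "PiM {..<k} (\<lambda>_. count_space D) = count_space Q"
    unfolding Q_def using D by (intro count_space_PiM_finite) (auto intro: countable_finite)
  have "indep_var (PiM {..<k} (\<lambda>_. count_space D)) (\<lambda>w. restrict (\<lambda>i. \<xi> i w) {..<k})
      (PiM {k} (\<lambda>_. count_space D)) (\<lambda>w. restrict (\<lambda>i. \<xi> i w) {k})"
    by (rule indep_var_restrict[OF indep]) auto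
  note indep_past = this
  have ZQ: "Z (\<lambda>i\<in>{..<k}. \<xi> i w) = Z (\<lambda>i. \<xi> i w)" for w
    unfolding Z_def by (intro driven_orbit_cong) simp
  have past: "(\<lambda>w. \<lambda>i\<in>{..<k}. \<xi> i w) \<in> measurable M (count_space Q)"
    using indep_past by (simp add: indep_var_eq PiM)
  have "Z \<in> measurable (count_space Q) (count_space (Z ` Q))"
    by auto
  with past have Z: "(\<lambda>w. Z (\<lambda>i. \<xi> i w)) \<in> measurable M (count_space (Z ` Q))"
    unfolding ZQ[symmetric] by (rule measurable_compose)
  have \<xi>: "\<xi> k \<in> measurable M (count_space D)"
    using indep by (simp add: indep_vars_def)
  have prod: "prob {w \<in> space M. Z (\<lambda>i. \<xi> i w) = z \<and> \<xi> k w = d} =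
      prob {w \<in> space M. Z (\<lambda>i. \<xi> i w) = z} * prob {w \<in> space M. \<xi> k w = d}" if "d \<in> D" for z d
  proof -
    \<comment> \<open>The event \<open>\<xi> k w = d\<close>, expressed as a set in the
      one-coordinate product space on which the independence statement lives.\<close>
    define K where "K = PiE {k} (\<lambda>_. {d})"
    have K: "(\<lambda>i\<in>{k}. \<xi> i w) \<in> K \<longleftrightarrow> \<xi> k w = d" for w
      unfolding K_def restrict_PiE_iff by simp
    have "K \<in> sets (PiM {k} (\<lambda>_. count_space D))"
      unfolding K_def using that by (intro sets_PiM_I_finite) auto
    moreover have "{q \<in> Q. Z q = z} \<in> sets (PiM {..<k} (\<lambda>_. count_space D))"
      by (simp add: PiM)
    moreover note indep_varD[OF indep_past, of "{q \<in> Q. Z q = z}" K]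
    moreover have "(\<lambda>w. \<lambda>i\<in>{..<k}. \<xi> i w) -` {q \<in> Q. Z q = z} \<inter> space M =
        {w \<in> space M. Z (\<lambda>i. \<xi> i w) = z}"
      using measurable_space[OF past] by (auto simp: ZQ)
    moreover have "(\<lambda>w. \<lambda>i\<in>{k}. \<xi> i w) -` K \<inter> space M =
        {w \<in> space M. \<xi> k w = d}"
      by (auto simp: K)
    moreover have "(\<lambda>w. (\<lambda>i\<in>{..<k}. \<xi> i w, \<lambda>i\<in>{k}. \<xi> i w)) -`
        ({q \<in> Q. Z q = z} \<times> K) \<inter> space M =
        {w \<in> space M. Z (\<lambda>i. \<xi> i w) = z \<and> \<xi> k w = d}"
      using measurable_space[OF past] by (auto simp: ZQ K)
    ultimately show ?thesis by simp
  qed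
  have "finite (Z ` Q)"
    using \<open>finite Q\<close> by simp
  from finite_range_indep_expectation_le[OF this D Z \<xi> prod le]
  have "integrable M (\<lambda>w. g (driven_orbit f z0 (\<lambda>i. \<xi> i w) (Suc k)))"
    and "expectation (\<lambda>w. g (driven_orbit f z0 (\<lambda>i. \<xi> i w) (Suc k))) \<le>
      c * expectation (\<lambda>w. g (driven_orbit f z0 (\<lambda>i. \<xi> i w) k))"
    by (simp_all add: Z_def)
  moreover have "c * expectation (\<lambda>w. g (driven_orbit f z0 (\<lambda>i. \<xi> i w) k)) \<le> c * (c ^ k * g z0)"
    using Suc c by (intro mult_left_mono) auto
  ultimately show ?case by (simp add: mult.assoc)
qed

section \<open>The law of one random choice and ELVIRA as a driven orbit\<close>

text \<open>Where \<open>s\<close> holds, the law of \<open>\<Omega>\<close> is arbitrary, but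
  \<open>\<phi>\<close> is constant there, so only the total mass \<open>p\<close> matters. Where
  \<open>s\<close> fails, the subsets of size \<open>N\<close> already carry the whole mass
  \<open>1 - p\<close>.\<close>

lemma elvira_sampling_weighted_sum:
  fixes \<phi> :: "bool \<times> nat set \<Rightarrow> real"
  assumes "prob_space P" and sampling: "elvira_sampling P M N p s \<Omega>" and N: "N \<le> M"
    and \<phi>: "\<And>A. \<phi> (True, A) = r"
  shows "(\<Sum>d\<in>UNIV \<times> Pow {1..M}. measure P {w \<in> space P. (s k w, \<Omega> k w) = d} * \<phi> d) =
    p * r + (1 - p) / real (M choose N) * (\<Sum>A | A \<subseteq> {1..M} \<and> card A = N. \<phi> (False, A))"
proof -
  interpret prob_space P by fact
  let ?D = "(UNIV :: bool set) \<times> Pow {1..M}" and ?S = "{A. A \<subseteq> {1..M} \<and> card A = N}"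
  define W where "W d = prob {w \<in> space P. (s k w, \<Omega> k w) = d}" for d
  have X: "(\<lambda>w. (s k w, \<Omega> k w)) \<in> measurable P (count_space ?D)"
    using sampling by (auto simp: elvira_sampling_def indep_vars_def)
  have fin: "finite ?D"
    by (intro finite_cartesian_product) auto
  have split: "(\<Sum>d\<in>?D. u d) = (\<Sum>A\<in>Pow {1..M}. u (True, A)) + (\<Sum>A\<in>Pow {1..M}. u (False, A))"
    for u :: "bool \<times> nat set \<Rightarrow> real"
    by (simp add: sum.cartesian_product' UNIV_bool)
  have events: "{w \<in> space P. s k w} \<in> events"
  proof -
    have "(\<lambda>w. (s k w, \<Omega> k w)) -` ({True} \<times> Pow {1..M}) \<inter> space P \<in> events"
      by (rule measurable_sets[OF X]) auto
    moreover have "(\<lambda>w. (s k w, \<Omega> k w)) -` ({True} \<times> Pow {1..M}) \<inter> space P = {w \<in> space P. s k w}"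
      using measurable_space[OF X] by auto
    ultimately show ?thesis by simp
  qed
  have "(\<Sum>d\<in>?D. W d * of_bool (fst d)) = expectation (\<lambda>w. of_bool (s k w))"
    using finite_range_has_bochner_integral[OF fin X, of "\<lambda>d. of_bool (fst d)"]
    by (simp add: W_def has_bochner_integral_integral_eq)
  also have "\<dots> = expectation (indicator {w \<in> space P. s k w})"
    by (intro Bochner_Integration.integral_cong) (auto simp: indicator_def)
  also have "\<dots> = p"
    using sampling events by (simp add: elvira_sampling_def Int_absorb1)
  finally have WT: "(\<Sum>A\<in>Pow {1..M}. W (True, A)) = p"
    unfolding split by simp
  have "(\<Sum>d\<in>?D. W d * 1) = expectation (\<lambda>w. 1)"
    using has_bochner_integral_integral_eq[OF finite_range_has_bochner_integral[OF fin X, of "\<lambda>_. 1"]]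
    by (simp only: W_def)
  then have WF: "(\<Sum>A\<in>Pow {1..M}. W (False, A)) = 1 - p"
    using WT unfolding split by (simp add: prob_space)
  have unif: "W (False, A) = (1 - p) / real (M choose N)" if "A \<in> ?S" for A
    using sampling that by (simp add: W_def elvira_sampling_def)
  have "(\<Sum>A\<in>?S. W (False, A)) = 1 - p"
    using N by (simp add: unif n_subsets)
  moreover have "(\<Sum>A\<in>Pow {1..M}. W (False, A)) =
      (\<Sum>A\<in>Pow {1..M} - ?S. W (False, A)) + (\<Sum>A\<in>?S. W (False, A))"
    by (rule sum.subset_diff) auto
  \<comment> \<open>Nonnegative weights with zero sum all vanish, so sets of the wrong size drop
    out.\<close>
  ultimately have "(\<Sum>A\<in>Pow {1..M} - ?S. W (False, A)) = 0"
    using WF by simp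
  then have other: "W (False, A) = 0" if "A \<in> Pow {1..M} - ?S" for A
    using that by (subst (asm) sum_nonneg_eq_0_iff) (auto simp: W_def)
  have "(\<Sum>A\<in>Pow {1..M}. W (False, A) * \<phi> (False, A)) = (\<Sum>A\<in>?S. W (False, A) * \<phi> (False, A))"
    using other by (intro sum.mono_neutral_right) auto
  also have "\<dots> = (1 - p) / real (M choose N) * (\<Sum>A\<in>?S. \<phi> (False, A))"
    unfolding sum_distrib_left by (intro sum.cong refl) (simp add: unif)
  finally have F: "(\<Sum>A\<in>Pow {1..M}. W (False, A) * \<phi> (False, A)) =
    (1 - p) / real (M choose N) * (\<Sum>A\<in>?S. \<phi> (False, A))" .
  have "(\<Sum>A\<in>Pow {1..M}. W (True, A) * \<phi> (True, A)) = p * r"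
    by (simp only: \<phi> WT flip: sum_distrib_right)
  with F show ?thesis
    unfolding W_def[symmetric] split by (simp only:)
qed

text \<open>The state is the pair of \<open>x\<close> and \<open>y\<close>; the vector
  \<open>h\<close> of the algorithm is replaced by the average gradient at \<open>y\<close>.\<close>

definition elvira_step ::
  "nat \<Rightarrow> nat \<Rightarrow> (nat \<Rightarrow> 'a::euclidean_space \<Rightarrow> real) \<Rightarrow> ('a \<Rightarrow> ereal) \<Rightarrow> real \<Rightarrow>
   'a \<times> 'a \<Rightarrow> bool \<times> nat set \<Rightarrow> 'a \<times> 'a" where
  "elvira_step M N F R \<gamma> = (\<lambda>(x, y) (s, A).
     if s then (prox \<gamma> R (x - \<gamma> *\<^sub>R avg {1..M} (\<lambda>m. gradient (F m) x)), x)
     else (prox \<gamma> R (x - \<gamma> *\<^sub>R (avg {1..M} (\<lambda>m. gradient (F m) y) +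
       (1 / real N) *\<^sub>R (\<Sum>m\<in>A. gradient (F m) x - gradient (F m) y))), y))"

text \<open>The induction carries the invariant that \<open>h\<close> is the average gradient at
  \<open>y\<close>, which holds at the start, is renewed when \<open>s\<close> holds and is
  preserved otherwise.\<close>

lemma elvira_run_orbit:
  assumes run: "elvira_run M N F R \<gamma> x0 s \<Omega> x h y"
  shows "(x k, y k) = driven_orbit (elvira_step M N F R \<gamma>) (x0, x0) (\<lambda>i. (s i, \<Omega> i)) k"
proof -
  have "driven_orbit (elvira_step M N F R \<gamma>) (x0, x0) (\<lambda>i. (s i, \<Omega> i)) k = (x k, y k) \<and>
      h k = avg {1..M} (\<lambda>m. gradient (F m) (y k))"
  proof (induction k)
    case 0
    then show ?case
      using run by (simp add: elvira_run_def)
  next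
    case (Suc k)
    then show ?case
      using run unfolding elvira_run_def
      by (cases "s k") (auto simp: elvira_step_def Let_def dest!: spec[of _ k])
  qed
  then show ?thesis by simp
qed

theorem theorem11:
  fixes P :: "'w measure"
    and M N :: nat
    and F :: "nat \<Rightarrow> real ^ 'n \<Rightarrow> real"
    and R :: "real ^ 'n \<Rightarrow> ereal"
    and L \<mu> \<gamma> p b \<omega>av a c :: real
    and x0 xstar :: "real ^ 'n"
    and s :: "nat \<Rightarrow> 'w \<Rightarrow> bool"
    and \<Omega> :: "nat \<Rightarrow> 'w \<Rightarrow> nat set"
    and x h y :: "nat \<Rightarrow> 'w \<Rightarrow> real ^ 'n"
    and \<Psi> :: "real ^ 'n \<Rightarrow> real ^ 'n \<Rightarrow> real"
  assumes "M \<ge> 1"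
    and "L > 0"
    and "\<mu> > 0"
    and "\<And>m. m \<in> {1..M} \<Longrightarrow> convex_on UNIV (F m)"
    and "\<And>m z. m \<in> {1..M} \<Longrightarrow> F m differentiable (at z)"
    and "\<And>m. m \<in> {1..M} \<Longrightarrow> L-lipschitz_on UNIV (gradient (F m))"
    and "strongly_convex \<mu> (\<lambda>z. avg {1..M} (\<lambda>m. F m z))"
    and "proper_closed_convex R"
    and "xstar = minimizer (\<lambda>z. R z + ereal (avg {1..M} (\<lambda>m. F m z)))"
    and "N \<in> {1..M}"
    and "p \<in> {0<..1}"
    and "b > 1"
    and "\<omega>av = sampling_ratio M N * (1 - p)"
    and "a = max (1 - (1 + b) * (1 - p) * sampling_ratio M N) 0"
    and "0 < \<gamma>"
    and "\<gamma> \<le> 1 / L * (1 / (a + (1 + b)\<^sup>2 * \<omega>av))"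
    and "prob_space P"
    and "elvira_sampling P M N p s \<Omega>"
    and "\<And>w. w \<in> space P \<Longrightarrow>
           elvira_run M N F R \<gamma> x0 (\<lambda>k. s k w) (\<lambda>k. \<Omega> k w) (\<lambda>k. x k w) (\<lambda>k. h k w) (\<lambda>k. y k w)"
    and "\<Psi> = (\<lambda>u v. (norm (u - xstar))\<^sup>2 + (b\<^sup>2 + b) * \<gamma>\<^sup>2 * \<omega>av * (1 / (p * real M)) *
           (\<Sum>m\<in>{1..M}. (norm (gradient (F m) v - gradient (F m) xstar))\<^sup>2))"
    and "c = 1 - min (\<gamma> * \<mu>) (p * (1 - 1 / b\<^sup>2))"
  shows "\<forall>k. integrable P (\<lambda>w. \<Psi> (x k w) (y k w)) \<and>
             prob_space.expectation P (\<lambda>w. \<Psi> (x k w) (y k w)) \<le> c ^ k * \<Psi> x0 x0"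
proof
  fix k
  interpret prob_space P by fact
  let ?f = "elvira_step M N F R \<gamma>" and ?D = "(UNIV :: bool set) \<times> Pow {1..M}"
  let ?g = "\<lambda>z. \<Psi> (fst z) (snd z)"
  have grad: "GDERIV (F m) z :> gradient (F m) z" if "m \<in> {1..M}" for m z
    by (rule GDERIV_gradient) (use assms(5) that in blast)
  have avg_grad: "GDERIV (\<lambda>z. avg {1..M} (\<lambda>m. F m z)) z :> avg {1..M} (\<lambda>m. gradient (F m) z)" for z
    using grad unfolding gderiv_def avg_def inner_scaleR_right inner_sum_right real_scaleR_def
    by (intro has_derivative_mult_right has_derivative_sum) auto
  \<comment> \<open>One entry of the minimum is at most 1, so \<open>c\<close> is nonnegative and
    the one-step bound may be iterated.\<close>
  have "p * (1 - 1 / b\<^sup>2) \<le> 1 * 1"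
    using assms(11,12) by (intro mult_mono) auto
  then have "c \<ge> 0"
    using assms(21) by linarith
  moreover have "(\<Sum>d\<in>?D. prob {w \<in> space P. (s k w, \<Omega> k w) = d} * ?g (?f z d)) \<le> c * ?g z" for k z
  proof -
    obtain u v where z: "z = (u, v)" by fastforce
    define T where "T e = prox \<gamma> R (u - \<gamma> *\<^sub>R e)" for e
    have "(\<Sum>d\<in>?D. prob {w \<in> space P. (s k w, \<Omega> k w) = d} * ?g (?f z d)) =
        p * \<Psi> (T (avg {1..M} (\<lambda>m. gradient (F m) u))) u +
        (1 - p) / real (M choose N) * (\<Sum>A | A \<subseteq> {1..M} \<and> card A = N.
          \<Psi> (T (avg {1..M} (\<lambda>m. gradient (F m) v) +
            (1 / real N) *\<^sub>R (\<Sum>m\<in>A. gradient (F m) u - gradient (F m) v))) v)"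
      using elvira_sampling_weighted_sum[OF assms(17,18), where \<phi> = "\<lambda>d. ?g (?f z d)"
          and r = "\<Psi> (T (avg {1..M} (\<lambda>m. gradient (F m) u))) u"] assms(10)
      by (simp add: z elvira_step_def T_def)
    also have "\<dots> \<le> c * \<Psi> u v"
    proof (rule elvira_one_step[where L = L and \<mu> = \<mu>])
      show "(norm (gradient (F m) u - gradient (F m) xstar))\<^sup>2 / L \<le>
          (gradient (F m) u - gradient (F m) xstar) \<bullet> (u - xstar)" if "m \<in> {1..M}" for m
        by (rule gradient_cocoercive[OF assms(4)[OF that] grad[OF that] assms(6)[OF that] assms(2)])
      show "\<mu> * (norm (u - xstar))\<^sup>2 \<le> (avg {1..M} (\<lambda>m. gradient (F m) u) -
          avg {1..M} (\<lambda>m. gradient (F m) xstar)) \<bullet> (u - xstar)"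
        by (rule strongly_convex_gradient_monotone[OF assms(7) avg_grad avg_grad])
      show "norm (T e - xstar) \<le>
          norm (u - xstar - \<gamma> *\<^sub>R (e - avg {1..M} (\<lambda>m. gradient (F m) xstar)))" for e
        unfolding T_def
        by (rule prox_forward_backward_nonexpansive[OF assms(8,15,7,3) avg_grad assms(9)])
    qed fact+
    finally show ?thesis by (simp add: z)
  qed
  moreover have "indep_vars (\<lambda>_. count_space ?D) (\<lambda>i w. (s i w, \<Omega> i w)) UNIV"
    using assms(18) by (simp add: elvira_sampling_def)
  moreover have "finite ?D"
    by (intro finite_cartesian_product) auto
  ultimately have "integrable P (\<lambda>w. ?g (driven_orbit ?f (x0, x0) (\<lambda>i. (s i w, \<Omega> i w)) k)) \<and>
      expectation (\<lambda>w. ?g (driven_orbit ?f (x0, x0) (\<lambda>i. (s i w, \<Omega> i w)) k)) \<le> c ^ k * ?g (x0, x0)"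
    by (intro driven_orbit_expectation_le[where D = ?D]) auto
  moreover have "?g (driven_orbit ?f (x0, x0) (\<lambda>i. (s i w, \<Omega> i w)) k) = \<Psi> (x k w) (y k w)"
    if "w \<in> space P" for w
    using elvira_run_orbit[OF assms(19)[OF that], of k, symmetric] by simp
  ultimately show "integrable P (\<lambda>w. \<Psi> (x k w) (y k w)) \<and>
      expectation (\<lambda>w. \<Psi> (x k w) (y k w)) \<le> c ^ k * \<Psi> x0 x0"
    by (simp cong: Bochner_Integration.integrable_cong Bochner_Integration.integral_cong)
qed

end
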